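(* Let $a>0$ and $T>0$, and let $u=u(x,t)$ be an arbitrary solution of $$u_t=u_{xx}\ \text{ in } ]0,a[\,\times\,]0,T[,\qquad u_x(a,t)=0\ \text{ for } t\in\,]0,T[,\qquad u(x,0)=0\ \text{ in } ]0,a[.$$ Let $M$ be a positive number with $M\ge 2a$, let $0<T'\le T$, and let $c>0$ satisfy $Mc<\min\{T,2T'\}$. Assume that $u_x(0,t)$ coincides on $]0,T'[$ with a polynomial in $t$ at least one of whose coefficients is not $0$. For square integrable functions $E_1,E_2$ on $]0,T[$ and $\tau>c^{-2}$ define $$I_c(\tau;E_1,E_2)=\int_0^T\bigl(-v_x(0,t)(u(0,t)+E_1(t))+(u_x(0,t)+E_2(t))v(0,t)\bigr)\,dt,$$ where $v(x,t)=e^{-z^2t}e^{xz}$ and $z=-c\tau\left(1+i\sqrt{1-\frac{1}{c^2\tau}}\right)$, and set $\|(E_1,E_2)\|=\|E_1\|_{L^2(0,T)}+\|E_2\|_{L^2(0,T)}$. Given $\delta>0$ (small) and $\sigma\in\,]0,1[$ define $$\tau_\sigma(\delta)=\frac{\sigma}{T}|\log\delta|.$$ Then, as $\delta\to0$, $$\sup_{\|(E_1,E_2)\|\le\delta}\left|\frac{\log|I_c(\tau_\sigma(\delta);E_1,E_2)|}{\tau_\sigma(\delta)}+2ca\right|=O\left(\frac{|\log|\log\delta||}{|\log\delta|}\right).$$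
   Context: $]\alpha,\beta[$ denotes an open interval. The function $v$ depends on the parameters $\tau$ and $c$; note $z^2=\tau+2ic^2\tau^2\sqrt{1-\frac{1}{c^2\tau}}$. In the $O$-statement the quantities $a,T,T',c,\sigma,u$ are fixed and $\delta\to0$. The paper does not specify a function class for solutions $u$; they are understood to be regular enough that the boundary values $u(0,t)$, $u_x(0,t)$, $u(a,t)$, the final value $u(x,T)$ and integrations by parts make sense. *)

theory Defs
  imports
    "HOL-Analysis.Analysis"
    "HOL-Library.Landau_Symbols"
    "HOL-Computational_Algebra.Polynomial"
begin

definition L1_limit ::
  "('s \<Rightarrow> real \<Rightarrow> real) \<Rightarrow> (real \<Rightarrow> real) \<Rightarrow> real set \<Rightarrow> 's filter \<Rightarrow> bool" where
  "L1_limit f l J F \<longleftrightarrow>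
     set_integrable lebesgue J l \<and>
     (\<forall>\<^sub>F s in F. set_integrable lebesgue J (f s)) \<and>
     ((\<lambda>s. LINT y:J|lebesgue. \<bar>f s y - l y\<bar>) \<longlongrightarrow> 0) F"

text \<open>
  Solutions of the heat equation in the open rectangle, without boundary or initial conditions.
  In the interior, u is a classical solution and \<open>ux\<close> is its x-derivative (every
  distributional solution is smooth there).  On the sides of the rectangle, the values of
  \<open>u\<close> and \<open>ux\<close> are traces in the sense of \<open>L1\<close>-convergence.  No continuity up to the boundary
  is imposed: already a constant nonzero flux \<open>ux 0 t\<close> together with zero initial
  data makes \<open>ux\<close> discontinuous at the corner (0,0).
\<close>
definition heat_solution ::
  "real \<Rightarrow> real \<Rightarrow> (real \<Rightarrow> real \<Rightarrow> real) \<Rightarrow> (real \<Rightarrow> real \<Rightarrow> real) \<Rightarrow> bool" where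
  "heat_solution a T u ux \<longleftrightarrow>
     (\<exists>ut uxx.
        continuous_on ({0<..<a} \<times> {0<..<T}) (\<lambda>(x, t). u x t) \<and>
        continuous_on ({0<..<a} \<times> {0<..<T}) (\<lambda>(x, t). ux x t) \<and>
        continuous_on ({0<..<a} \<times> {0<..<T}) (\<lambda>(x, t). ut x t) \<and>
        continuous_on ({0<..<a} \<times> {0<..<T}) (\<lambda>(x, t). uxx x t) \<and>
        (\<forall>x\<in>{0<..<a}. \<forall>t\<in>{0<..<T}.
           ((\<lambda>y. u y t) has_real_derivative ux x t) (at x) \<and>
           ((\<lambda>y. ux y t) has_real_derivative uxx x t) (at x) \<and>
           ((\<lambda>s. u x s) has_real_derivative ut x t) (at t) \<and>
           ut x t = uxx x t)) \<and>
     L1_limit u (u 0) {0<..<T} (at_right 0) \<and>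
     L1_limit u (u a) {0<..<T} (at_left a) \<and>
     L1_limit ux (ux 0) {0<..<T} (at_right 0) \<and>
     L1_limit ux (ux a) {0<..<T} (at_left a) \<and>
     L1_limit (\<lambda>t x. u x t) (\<lambda>x. u x 0) {0<..<a} (at_right 0) \<and>
     L1_limit (\<lambda>t x. u x t) (\<lambda>x. u x T) {0<..<a} (at_left T)"

definition zfreq :: "real \<Rightarrow> real \<Rightarrow> complex" where
  "zfreq c \<tau> =
     - complex_of_real (c * \<tau>) * (1 + \<i> * complex_of_real (sqrt (1 - 1 / (c\<^sup>2 * \<tau>))))"

definition vsol :: "real \<Rightarrow> real \<Rightarrow> real \<Rightarrow> real \<Rightarrow> complex" where
  "vsol c \<tau> x t = exp (- (zfreq c \<tau>)\<^sup>2 * complex_of_real t) * exp (complex_of_real x * zfreq c \<tau>)"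

definition vsol_x :: "real \<Rightarrow> real \<Rightarrow> real \<Rightarrow> real \<Rightarrow> complex" where
  "vsol_x c \<tau> x t = vector_derivative (\<lambda>y. vsol c \<tau> y t) (at x)"

definition I_c ::
  "real \<Rightarrow> (real \<Rightarrow> real \<Rightarrow> real) \<Rightarrow> (real \<Rightarrow> real \<Rightarrow> real) \<Rightarrow> real \<Rightarrow> real \<Rightarrow>
   (real \<Rightarrow> real) \<Rightarrow> (real \<Rightarrow> real) \<Rightarrow> complex" where
  "I_c T u ux c \<tau> E1 E2 =
     (LINT t:{0<..<T}|lebesgue.
        - vsol_x c \<tau> 0 t * complex_of_real (u 0 t + E1 t)
        + complex_of_real (ux 0 t + E2 t) * vsol c \<tau> 0 t)"

definition square_integrable :: "real \<Rightarrow> (real \<Rightarrow> real) \<Rightarrow> bool" where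
  "square_integrable T E \<longleftrightarrow>
     set_borel_measurable lebesgue {0<..<T} E \<and>
     set_integrable lebesgue {0<..<T} (\<lambda>t. (E t)\<^sup>2)"

definition L2_norm :: "real \<Rightarrow> (real \<Rightarrow> real) \<Rightarrow> real" where
  "L2_norm T E = sqrt (LINT t:{0<..<T}|lebesgue. (E t)\<^sup>2)"

definition noise_ball :: "real \<Rightarrow> real \<Rightarrow> ((real \<Rightarrow> real) \<times> (real \<Rightarrow> real)) set" where
  "noise_ball T \<delta> =
     {(E1, E2). square_integrable T E1 \<and> square_integrable T E2 \<and>
                L2_norm T E1 + L2_norm T E2 \<le> \<delta>}"

definition \<tau>_sel :: "real \<Rightarrow> real \<Rightarrow> real \<Rightarrow> real" where
  "\<tau>_sel T \<sigma> \<delta> = \<sigma> / T * \<bar>ln \<delta>\<bar>"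

definition deviation ::
  "real \<Rightarrow> real \<Rightarrow> (real \<Rightarrow> real \<Rightarrow> real) \<Rightarrow> (real \<Rightarrow> real \<Rightarrow> real) \<Rightarrow> real \<Rightarrow> real \<Rightarrow>
   (real \<Rightarrow> real) \<times> (real \<Rightarrow> real) \<Rightarrow> real" where
  "deviation a T u ux c \<tau> = (\<lambda>(E1, E2).
     \<bar>ln (cmod (I_c T u ux c \<tau> E1 E2)) / \<tau> + 2 * c * a\<bar>)"

end

theory Submission
  imports Defs "HOL-Real_Asymp.Real_Asymp"
begin

text \<open>
  Write \<open>\<omega> = z\<^sup>2\<close>, so that \<open>Re \<omega> = \<tau>\<close> and \<open>Re z = - c \<tau>\<close>, and let \<open>F\<close>, \<open>U\<close>, \<open>W\<close> be the integrals of
  \<open>ux 0\<close>, \<open>u 0\<close> and \<open>u a\<close> over \<open>(0,T)\<close> against \<open>exp (- \<omega> t)\<close>.  Without noise the indicator is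
  \<open>F - z U\<close>.  Testing the heat equation with the two solutions \<open>exp (- \<omega> t) exp (z x)\<close> and
  \<open>exp (- \<omega> t) exp (- z x)\<close> of the backward equation (lemma \<open>heat_green_identity\<close>) yields two linear
  relations between \<open>F\<close>, \<open>U\<close>, \<open>W\<close> and the final state.  Eliminating the unobserved \<open>W\<close> gives
  (lemma \<open>insulated_heat_boundary_combination\<close>)

    \<open>(1 - exp (2 a z)) (F - z U) = - 2 exp (2 a z) F + O(exp (- T \<tau>))\<close>,

  where the error comes from the final state.  The factor \<open>exp (2 a z)\<close>, of modulus \<open>exp (- 2 c a \<tau>)\<close>,
  is the trace of a signal that travels to the insulated end and back.

  The transform \<open>F\<close> does not spoil this rate.  It is bounded, and because the flux is a nonzero
  polynomial on \<open>(0,T')\<close>, repeated integration by parts shows that it decays no faster than a power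
  of \<open>\<tau>\<close>; the flux after \<open>T'\<close> only contributes \<open>O(exp (- T' \<tau>))\<close> (lemmas
  \<open>trunc_laplace_poly_lower_bound\<close> and \<open>trunc_laplace_tail\<close>).  Noise of size \<open>\<delta> = exp (- T \<tau> / \<sigma>)\<close>
  changes the indicator by \<open>O(\<tau> \<delta>)\<close>.  Since \<open>2 a c \<le> M c < T\<close> and \<open>\<sigma> < 1\<close>, both the final state and the
  noise are exponentially smaller than the main term, uniformly over the ball.  Hence
  (lemma \<open>indicator_two_sided_bound\<close>)

    \<open>C1 \<tau>\<^sup>-\<^sup>m exp (- 2 c a \<tau>) \<le> |I| \<le> C2 exp (- 2 c a \<tau>)\<close>,

  and taking logarithms leaves an error of order \<open>ln \<tau> / \<tau>\<close>, where \<open>\<tau>\<close> is proportional to \<open>|ln \<delta>|\<close>.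
\<close>

section \<open>Integrals against bounded weights, and traces\<close>

lemma set_integral_bounded_mult:
  fixes \<phi> :: "real \<Rightarrow> complex" and f :: "real \<Rightarrow> real"
  assumes f: "set_integrable lebesgue J f" and J: "J \<in> sets lebesgue"
    and \<phi>: "\<phi> \<in> borel_measurable borel" and B: "\<And>y. y \<in> J \<Longrightarrow> norm (\<phi> y) \<le> B"
  shows "set_integrable lebesgue J (\<lambda>y. \<phi> y * of_real (f y))"
    and "norm (LINT y:J|lebesgue. \<phi> y * of_real (f y)) \<le> B * (LINT y:J|lebesgue. \<bar>f y\<bar>)"
proof -
  have [measurable]: "\<phi> \<in> borel_measurable lebesgue"
    using \<phi> by (simp add: measurable_completion)
  have fi: "integrable lebesgue (\<lambda>y. indicator J y * f y)"
    using f by (simp add: set_integrable_def)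
  hence fm [measurable]: "(\<lambda>y. indicator J y * f y) \<in> borel_measurable lebesgue" by auto
  have ai: "integrable lebesgue (\<lambda>y. B * \<bar>indicator J y * f y\<bar>)"
    using fi by auto
  have eq: "(\<lambda>y. indicat_real J y *\<^sub>R (\<phi> y * complex_of_real (f y)))
      = (\<lambda>y. \<phi> y * complex_of_real (indicator J y * f y))"
    by (auto simp: fun_eq_iff indicator_def)
  have le: "norm (indicat_real J y *\<^sub>R (\<phi> y * complex_of_real (f y))) \<le> B * \<bar>indicator J y * f y\<bar>" for y
    using B[of y] by (auto simp: indicator_def norm_mult intro: mult_right_mono)
  have m: "(\<lambda>y. indicat_real J y *\<^sub>R (\<phi> y * complex_of_real (f y))) \<in> borel_measurable lebesgue"
    unfolding eq by measurable
  show *: "set_integrable lebesgue J (\<lambda>y. \<phi> y * of_real (f y))"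
    unfolding set_integrable_def
    by (rule Bochner_Integration.integrable_bound[OF ai m]) (use order_trans[OF le abs_ge_self] in \<open>simp add: always_eventually\<close>)
  have "norm (LINT y:J|lebesgue. \<phi> y * of_real (f y)) \<le> (LINT y|lebesgue. B * \<bar>indicator J y * f y\<bar>)"
    unfolding set_lebesgue_integral_def
    by (rule Bochner_Integration.integral_norm_bound_integral) (use * ai le in \<open>auto simp: set_integrable_def\<close>)
  also have "\<dots> = B * (LINT y:J|lebesgue. \<bar>f y\<bar>)"
    by (simp add: set_lebesgue_integral_def abs_mult)
  finally show "norm (LINT y:J|lebesgue. \<phi> y * of_real (f y)) \<le> B * (LINT y:J|lebesgue. \<bar>f y\<bar>)" .
qed

text \<open>
  This is how a trace enters every formula below: \<open>L1\<close>-convergence is exactly what lets a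
  bounded weight be integrated against the trace, with no pointwise convergence at the boundary.
\<close>
lemma L1_limit_weighted:
  fixes \<phi> :: "real \<Rightarrow> complex"
  assumes L: "L1_limit f l J F" and J: "J \<in> sets lebesgue"
    and \<phi>: "\<phi> \<in> borel_measurable borel" and B: "\<And>y. y \<in> J \<Longrightarrow> norm (\<phi> y) \<le> B"
  shows "((\<lambda>s. LINT y:J|lebesgue. \<phi> y * of_real (f s y)) \<longlongrightarrow> (LINT y:J|lebesgue. \<phi> y * of_real (l y))) F"
proof (rule Lim_null[THEN iffD2], rule tendsto_0_le[where K = "B"])
  show "((\<lambda>s. LINT y:J|lebesgue. \<bar>f s y - l y\<bar>) \<longlongrightarrow> 0) F"
    using L by (simp add: L1_limit_def)
  have l: "set_integrable lebesgue J l" and "\<forall>\<^sub>F s in F. set_integrable lebesgue J (f s)"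
    using L by (auto simp: L1_limit_def)
  from this(2) show "\<forall>\<^sub>F s in F. norm ((LINT y:J|lebesgue. \<phi> y * of_real (f s y)) - (LINT y:J|lebesgue. \<phi> y * of_real (l y)))
      \<le> norm (LINT y:J|lebesgue. \<bar>f s y - l y\<bar>) * B"
  proof eventually_elim
    case (elim s)
    have "(LINT y:J|lebesgue. \<phi> y * of_real (f s y)) - (LINT y:J|lebesgue. \<phi> y * of_real (l y))
       = (LINT y:J|lebesgue. \<phi> y * of_real (f s y - l y))"
      using set_integral_bounded_mult(1)[OF elim J \<phi> B] set_integral_bounded_mult(1)[OF l J \<phi> B]
      by (subst set_integral_diff(2)[symmetric]) (auto simp: algebra_simps)
    also have "norm \<dots> \<le> B * (LINT y:J|lebesgue. \<bar>f s y - l y\<bar>)"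
      by (rule set_integral_bounded_mult(2)[OF _ J \<phi> B]) (use elim l in auto)
    also have "(LINT y:J|lebesgue. \<bar>f s y - l y\<bar>) \<ge> 0"
      by (auto simp: set_lebesgue_integral_def intro!: integral_nonneg_AE)
    hence "B * (LINT y:J|lebesgue. \<bar>f s y - l y\<bar>) = norm (LINT y:J|lebesgue. \<bar>f s y - l y\<bar>) * B"
      by (simp add: mult.commute)
    finally show ?case .
  qed
qed

text \<open>
  The fundamental theorem of calculus for an integrand that is only integrable up to the ends,
  with the antiderivative known through its one-sided limits.  The predicates \<open>P\<close> and \<open>R\<close> are
  there because a function with traces need not have integrable restrictions to every line, only
  to lines sufficiently close to the boundary.
\<close>
lemma open_interval_integral_eqI:
  fixes k Q :: "real \<Rightarrow> complex"
  assumes L: "0 < L" and k: "set_integrable lebesgue {0<..<L} k"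
    and P: "\<forall>\<^sub>F \<alpha> in at_right 0. P \<alpha>" and R: "\<forall>\<^sub>F \<beta> in at_left L. R \<beta>"
    and eq: "\<And>\<alpha> \<beta>. P \<alpha> \<Longrightarrow> R \<beta> \<Longrightarrow> 0 < \<alpha> \<Longrightarrow> \<alpha> \<le> \<beta> \<Longrightarrow> \<beta> < L \<Longrightarrow>
               (LINT x:{\<alpha>..\<beta>}|lebesgue. k x) = Q \<beta> - Q \<alpha>"
    and A: "(Q \<longlongrightarrow> A) (at_right 0)" and B: "(Q \<longlongrightarrow> B) (at_left L)"
  shows "(LINT x:{0<..<L}|lebesgue. k x) = B - A"
proof -
  \<comment> \<open>The shift by 3 keeps the left end point below the right one already for n = 0.\<close>
  define e where "e n = L / real (n + 3)" for n
  have e0: "e \<longlonglongrightarrow> 0" unfolding e_def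
    by (rule LIMSEQ_ignore_initial_segment, rule lim_const_over_n)
  have pos: "0 < e n" "e n \<le> L - e n" "L - e n < L" for n
    using L by (auto simp: e_def field_simps)
  have er: "filterlim e (at_right 0) sequentially"
    using e0 pos(1) by (auto simp: filterlim_at less_imp_neq[THEN not_sym])
  have "(\<lambda>n. L - e n) \<longlonglongrightarrow> L - 0" by (intro tendsto_intros e0)
  hence el: "filterlim (\<lambda>n. L - e n) (at_left L) sequentially"
    using pos(1) by (auto simp: filterlim_at less_imp_neq[THEN not_sym])
  have un: "(\<Union>n. {e n..L - e n}) = {0<..<L}"
  proof (intro equalityI subsetI)
    fix x assume x: "x \<in> {0<..<L}"
    hence "\<forall>\<^sub>F n in sequentially. e n < min x (L - x)"
      by (intro order_tendstoD(2)[OF e0]) auto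
    then obtain n where "e n < min x (L - x)" by (auto simp: eventually_sequentially)
    thus "x \<in> (\<Union>n. {e n..L - e n})" by (auto intro!: exI[of _ n])
  next
    fix x assume "x \<in> (\<Union>n. {e n..L - e n})"
    then obtain n where "e n \<le> x" "x \<le> L - e n" by auto
    thus "x \<in> {0<..<L}" using pos(1)[of n] by auto
  qed
  have mono: "incseq (\<lambda>n. {e n..L - e n})"
  proof (rule incseq_SucI)
    fix n have "e (Suc n) \<le> e n" using L by (auto simp: e_def field_simps)
    thus "{e n..L - e n} \<le> {e (Suc n)..L - e (Suc n)}" by auto
  qed
  have lim: "(\<lambda>n. LINT x:{e n..L - e n}|lebesgue. k x) \<longlonglongrightarrow> (LINT x:{0<..<L}|lebesgue. k x)"
    using set_integral_cont_up[of "\<lambda>n. {e n..L - e n}" lebesgue k] mono k unfolding un by auto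
  have "\<forall>\<^sub>F n in sequentially. P (e n)" "\<forall>\<^sub>F n in sequentially. R (L - e n)"
    using P R er el by (auto simp: filterlim_iff)
  hence "\<forall>\<^sub>F n in sequentially. Q (L - e n) - Q (e n) = (LINT x:{e n..L - e n}|lebesgue. k x)"
    by eventually_elim (use eq pos in auto)
  moreover have "(\<lambda>n. Q (L - e n) - Q (e n)) \<longlonglongrightarrow> B - A"
    by (intro tendsto_diff filterlim_compose[OF B el] filterlim_compose[OF A er])
  ultimately have "(\<lambda>n. LINT x:{e n..L - e n}|lebesgue. k x) \<longlonglongrightarrow> B - A"
    by (rule Lim_transform_eventually[rotated])
  with lim show ?thesis by (rule LIMSEQ_unique)
qed

section \<open>Truncated Laplace transforms\<close>

text \<open>
  One transform serves both variables: for traces on the sides it is taken in time at \<open>\<omega> = z\<^sup>2\<close>,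
  and for a state at a fixed time it is taken in space at \<open>\<omega> = - z\<close>.
\<close>
definition trunc_laplace :: "real \<Rightarrow> complex \<Rightarrow> (real \<Rightarrow> real) \<Rightarrow> complex" where
  "trunc_laplace T \<omega> f = (LINT t:{0<..<T}|lebesgue. exp (- \<omega> * of_real t) * of_real (f t))"

lemma exp_bounded_on_interval:
  fixes \<omega> :: complex
  assumes "t \<in> {0<..<T}"
  shows "norm (exp (- \<omega> * of_real t)) \<le> exp (\<bar>Re \<omega>\<bar> * T)"
proof -
  have "- (Re \<omega> * t) \<le> \<bar>Re \<omega>\<bar> * t" using assms by (auto simp: abs_if mult_le_0_iff)
  also have "\<dots> \<le> \<bar>Re \<omega>\<bar> * T" using assms by (auto intro: mult_left_mono)
  finally show ?thesis by (simp add: norm_exp_eq_Re)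
qed

lemma exp_measurable: "(\<lambda>t::real. exp (- \<omega> * of_real t) :: complex) \<in> borel_measurable borel"
  by (intro borel_measurable_continuous_onI continuous_intros)

lemma trunc_laplace_integrable:
  assumes "set_integrable lebesgue {0<..<T} f"
  shows "set_integrable lebesgue {0<..<T} (\<lambda>t. exp (- \<omega> * of_real t) * of_real (f t) :: complex)"
  by (rule set_integral_bounded_mult(1)[OF assms _ exp_measurable exp_bounded_on_interval]) auto

lemma norm_trunc_laplace_le:
  assumes "set_integrable lebesgue {0<..<T} f" "Re \<omega> \<ge> 0"
  shows "norm (trunc_laplace T \<omega> f) \<le> (LINT t:{0<..<T}|lebesgue. \<bar>f t\<bar>)"
proof -
  have "norm (trunc_laplace T \<omega> f) \<le> 1 * (LINT t:{0<..<T}|lebesgue. \<bar>f t\<bar>)"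
    unfolding trunc_laplace_def
    by (rule set_integral_bounded_mult(2)[OF assms(1) _ exp_measurable])
       (use assms(2) in \<open>auto simp: norm_exp_eq_Re\<close>)
  thus ?thesis by simp
qed

lemma norm_trunc_laplace_le_exp:
  assumes "set_integrable lebesgue {0<..<T} f"
  shows "norm (trunc_laplace T \<omega> f) \<le> exp (\<bar>Re \<omega>\<bar> * T) * (LINT t:{0<..<T}|lebesgue. \<bar>f t\<bar>)"
  unfolding trunc_laplace_def
  by (rule set_integral_bounded_mult(2)[OF assms _ exp_measurable exp_bounded_on_interval]) auto

lemma trunc_laplace_L1_limit:
  assumes "L1_limit f l {0<..<T} F"
  shows "((\<lambda>s. trunc_laplace T \<omega> (f s)) \<longlongrightarrow> trunc_laplace T \<omega> l) F"
  unfolding trunc_laplace_def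
  by (rule L1_limit_weighted[OF assms _ exp_measurable exp_bounded_on_interval]) auto

section \<open>Green's identity for the heat equation\<close>

text \<open>
  With \<open>V(x,t) = exp (- z\<^sup>2 t) exp (z x)\<close> one has \<open>V\<^sub>t + V\<^sub>x\<^sub>x = 0\<close>, so by the heat equation
  \<open>(V u)\<^sub>t = (V u\<^sub>x - V\<^sub>x u)\<^sub>x\<close>: the weighted mass on an inner interval changes only through the flux
  \<open>V u\<^sub>x - V\<^sub>x u\<close>, called \<open>h\<close> here, at its two ends.
\<close>
lemma heat_weighted_mass_derivative:
  fixes z :: complex
  assumes ab: "0 < \<alpha>" "\<alpha> \<le> \<beta>" "\<beta> < a" and t: "t \<in> {0<..<T}"
    and cu: "continuous_on ({0<..<a} \<times> {0<..<T}) (\<lambda>(x, t). u x t)"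
    and cut: "continuous_on ({0<..<a} \<times> {0<..<T}) (\<lambda>(x, t). ut x t)"
    and ux: "\<And>x t. x \<in> {0<..<a} \<Longrightarrow> t \<in> {0<..<T} \<Longrightarrow> ((\<lambda>y. u y t) has_real_derivative ux x t) (at x)"
    and uxx: "\<And>x t. x \<in> {0<..<a} \<Longrightarrow> t \<in> {0<..<T} \<Longrightarrow> ((\<lambda>y. ux y t) has_real_derivative ut x t) (at x)"
    and ut: "\<And>x t. x \<in> {0<..<a} \<Longrightarrow> t \<in> {0<..<T} \<Longrightarrow> ((\<lambda>s. u x s) has_real_derivative ut x t) (at t)"
  defines "h \<equiv> \<lambda>x t. exp (- (z\<^sup>2) * of_real t) * (exp (z * of_real x) * (of_real (ux x t) - z * of_real (u x t)))"
  shows "((\<lambda>t. integral {\<alpha>..\<beta>} (\<lambda>x. exp (- (z\<^sup>2) * of_real t) * (exp (z * of_real x) * of_real (u x t))))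
          has_vector_derivative (h \<beta> t - h \<alpha> t)) (at t)"
proof -
  let ?f = "\<lambda>t x. exp (- (z\<^sup>2) * of_real t) * (exp (z * of_real x) * of_real (u x t))"
  let ?g = "\<lambda>t x. exp (- (z\<^sup>2) * of_real t) * (exp (z * of_real x) * (of_real (ut x t) - z\<^sup>2 * of_real (u x t)))"
  have sub: "{\<alpha>..\<beta>} \<subseteq> {0<..<a}" using ab by auto
  have du: "((\<lambda>s. complex_of_real (u x s)) has_vector_derivative of_real (ut x t)) (at t)"
    if "x \<in> {0<..<a}" "t \<in> {0<..<T}" for x t
    by (rule has_vector_derivative_of_real) (use ut[OF that] in \<open>simp add: has_real_derivative_iff_has_vector_derivative\<close>)
  have dux: "((\<lambda>y. complex_of_real (u y t)) has_vector_derivative of_real (ux x t)) (at x)"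
       "((\<lambda>y. complex_of_real (ux y t)) has_vector_derivative of_real (ut x t)) (at x)"
    if "x \<in> {0<..<a}" "t \<in> {0<..<T}" for x t
    by (rule has_vector_derivative_of_real, use ux[OF that] uxx[OF that] in \<open>simp add: has_real_derivative_iff_has_vector_derivative\<close>)+
  have de: "((\<lambda>s::real. exp (w * of_real s)) has_vector_derivative w * exp (w * of_real t)) (at t)" for w :: complex and t
    by (auto intro!: derivative_eq_intros has_vector_derivative_real_field)
  have "((\<lambda>t. integral (cbox \<alpha> \<beta>) (?f t)) has_vector_derivative integral (cbox \<alpha> \<beta>) (?g t)) (at t within {0<..<T})"
  proof (rule leibniz_rule_vector_derivative)
    fix s x assume s: "s \<in> {0<..<T}" and x: "x \<in> cbox \<alpha> \<beta>"
    hence x': "x \<in> {0<..<a}" using sub by auto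
    have "((\<lambda>s. ?f s x) has_vector_derivative ?g s x) (at s)"
      using has_vector_derivative_mult[OF de[of "- (z\<^sup>2)" s] has_vector_derivative_mult[OF has_vector_derivative_const[of "exp (z * of_real x)"] du[OF x' s]]]
      by (simp add: algebra_simps)
    thus "((\<lambda>s. ?f s x) has_vector_derivative ?g s x) (at s within {0<..<T})"
      by (rule has_vector_derivative_at_within)
  next
    fix s assume s: "s \<in> {0<..<T}"
    have "continuous_on (cbox \<alpha> \<beta>) (?f s)"
      by (intro continuous_intros continuous_on_compose2[OF cu, where f = "\<lambda>x. (x, s)", simplified])
         (use sub s in auto)
    thus "?f s integrable_on cbox \<alpha> \<beta>" by (rule integrable_continuous)
  next
    show "continuous_on ({0<..<T} \<times> cbox \<alpha> \<beta>) (\<lambda>(t, x). ?g t x)"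
      unfolding split_beta
      by (intro continuous_intros continuous_on_compose2[OF cu, where f = "\<lambda>p. (snd p, fst p)", simplified]
          continuous_on_compose2[OF cut, where f = "\<lambda>p. (snd p, fst p)", simplified])
         (use sub in auto)
  qed (use t in auto)
  hence A: "((\<lambda>t. integral {\<alpha>..\<beta>} (?f t)) has_vector_derivative integral {\<alpha>..\<beta>} (?g t)) (at t)"
    using t by (simp add: at_within_open[OF t])
  have "(?g t has_integral h \<beta> t - h \<alpha> t) {\<alpha>..\<beta>}"
  proof (rule fundamental_theorem_of_calculus[OF ab(2)])
    fix x assume "x \<in> {\<alpha>..\<beta>}"
    hence x: "x \<in> {0<..<a}" using sub by auto
    have "((\<lambda>x. h x t) has_vector_derivative ?g t x) (at x)"
      unfolding h_def
      using has_vector_derivative_mult[OF has_vector_derivative_const[of "exp (- (z\<^sup>2) * of_real t)"]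
         has_vector_derivative_mult[OF de[of z x] has_vector_derivative_diff[OF dux(2)[OF x t]
            has_vector_derivative_mult[OF has_vector_derivative_const[of z] dux(1)[OF x t]]]]]
      by (simp add: algebra_simps power2_eq_square)
    thus "((\<lambda>x. h x t) has_vector_derivative ?g t x) (at x within {\<alpha>..\<beta>})"
      by (rule has_vector_derivative_at_within)
  qed
  from A[unfolded integral_unique[OF this]] show ?thesis .
qed

text \<open>
  Green's identity on the whole rectangle, for test functions \<open>exp (- z\<^sup>2 t) exp (z x)\<close>.  The time
  interval is exhausted first, on a fixed inner interval \<open>[\<alpha>, \<beta>]\<close>, since the only boundary
  values that this needs are those at the initial and final time; the lateral traces then give the
  limits \<open>\<alpha> \<rightarrow> 0\<close>, \<open>\<beta> \<rightarrow> a\<close>.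
\<close>
lemma heat_green_identity:
  fixes z :: complex
  assumes a: "0 < a" and T: "0 < T" and heat: "heat_solution a T u ux"
  shows "exp (z * of_real a) * (trunc_laplace T (z\<^sup>2) (ux a) - z * trunc_laplace T (z\<^sup>2) (u a))
       - (trunc_laplace T (z\<^sup>2) (ux 0) - z * trunc_laplace T (z\<^sup>2) (u 0))
       = exp (- (z\<^sup>2) * of_real T) * trunc_laplace a (- z) (\<lambda>x. u x T) - trunc_laplace a (- z) (\<lambda>x. u x 0)"
proof -
  obtain ut uxx where
        cu: "continuous_on ({0<..<a} \<times> {0<..<T}) (\<lambda>(x, t). u x t)" and
        cut: "continuous_on ({0<..<a} \<times> {0<..<T}) (\<lambda>(x, t). ut x t)" and
        d0: "\<forall>x\<in>{0<..<a}. \<forall>t\<in>{0<..<T}.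
           ((\<lambda>y. u y t) has_real_derivative ux x t) (at x) \<and>
           ((\<lambda>y. ux y t) has_real_derivative uxx x t) (at x) \<and>
           ((\<lambda>s. u x s) has_real_derivative ut x t) (at t) \<and>
           ut x t = uxx x t"
    using heat unfolding heat_solution_def by blast
  have d: "((\<lambda>y. u y t) has_real_derivative ux x t) (at x)"
      "((\<lambda>y. ux y t) has_real_derivative ut x t) (at x)"
      "((\<lambda>s. u x s) has_real_derivative ut x t) (at t)"
    if "x \<in> {0<..<a}" "t \<in> {0<..<T}" for x t
  proof -
    note * = d0[rule_format, OF that]
    from * show "((\<lambda>y. u y t) has_real_derivative ux x t) (at x)" by blast
    from * show "((\<lambda>y. ux y t) has_real_derivative ut x t) (at x)" by (elim conjE) simp
    from * show "((\<lambda>s. u x s) has_real_derivative ut x t) (at t)" by blast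
  qed
  have tr: "L1_limit u (u 0) {0<..<T} (at_right 0)" "L1_limit u (u a) {0<..<T} (at_left a)"
     "L1_limit ux (ux 0) {0<..<T} (at_right 0)" "L1_limit ux (ux a) {0<..<T} (at_left a)"
     "L1_limit (\<lambda>t x. u x t) (\<lambda>x. u x 0) {0<..<a} (at_right 0)"
     "L1_limit (\<lambda>t x. u x t) (\<lambda>x. u x T) {0<..<a} (at_left T)"
    using heat unfolding heat_solution_def by auto
  define P where "P x \<longleftrightarrow> set_integrable lebesgue {0<..<T} (u x) \<and> set_integrable lebesgue {0<..<T} (ux x)" for x
  have P: "\<forall>\<^sub>F x in at_right 0. P x" "\<forall>\<^sub>F x in at_left a. P x"
    using tr(1-4) unfolding P_def L1_limit_def by (auto intro: eventually_conj)
  \<comment> \<open>The lateral flux, integrated over all times, as a function of the position.\<close>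
  define Q where "Q x = exp (z * of_real x) * (trunc_laplace T (z\<^sup>2) (ux x) - z * trunc_laplace T (z\<^sup>2) (u x))" for x
  define k where "k x = exp (- (z\<^sup>2) * of_real T) * (exp (z * of_real x) * of_real (u x T)) - exp (z * of_real x) * of_real (u x 0)" for x
  have ui: "set_integrable lebesgue {0<..<a} (\<lambda>x. exp (z * of_real x) * of_real (u x T))"
           "set_integrable lebesgue {0<..<a} (\<lambda>x. exp (z * of_real x) * of_real (u x 0))"
    using trunc_laplace_integrable[of a "\<lambda>x. u x T" "- z"] trunc_laplace_integrable[of a "\<lambda>x. u x 0" "- z"] tr(5,6)
    by (auto simp: L1_limit_def)
  have "(LINT x:{0<..<a}|lebesgue. k x) = Q a - Q 0"
  proof (rule open_interval_integral_eqI[OF a _ P])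
    show "set_integrable lebesgue {0<..<a} k"
      unfolding k_def using ui by auto
    show "(Q \<longlongrightarrow> Q 0) (at_right 0)" "(Q \<longlongrightarrow> Q a) (at_left a)"
      unfolding Q_def by (intro tendsto_intros trunc_laplace_L1_limit tr)+
  next
    fix \<alpha> \<beta> assume ab: "P \<alpha>" "P \<beta>" "0 < \<alpha>" "\<alpha> \<le> \<beta>" "\<beta> < a"
    \<comment> \<open>The integral over [\<alpha>, \<beta>] is written over the whole interval with a cut-off weight,
       because the traces at the initial and final time live on the whole interval.\<close>
    define m where "m t = (LINT y:{0<..<a}|lebesgue. (indicator {\<alpha>..\<beta>} y * exp (z * of_real y)) * of_real (u y t))" for t
    define h where "h x t = exp (- (z\<^sup>2) * of_real t) * (exp (z * of_real x) * (of_real (ux x t) - z * of_real (u x t)))" for x t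
    have hi: "set_integrable lebesgue {0<..<T} (h x)" "(LINT t:{0<..<T}|lebesgue. h x t) = Q x" if "P x" for x
    proof -
      have *: "h x = (\<lambda>t. exp (z * of_real x) * (exp (- (z\<^sup>2) * of_real t) * of_real (ux x t)
               - z * (exp (- (z\<^sup>2) * of_real t) * of_real (u x t))))"
        by (auto simp: h_def fun_eq_iff algebra_simps)
      have i: "set_integrable lebesgue {0<..<T} (\<lambda>t. exp (- (z\<^sup>2) * of_real t) * of_real (ux x t))"
        "set_integrable lebesgue {0<..<T} (\<lambda>t. exp (- (z\<^sup>2) * of_real t) * of_real (u x t))"
        using that trunc_laplace_integrable unfolding P_def by blast+
      show "set_integrable lebesgue {0<..<T} (h x)"
        unfolding * by (intro set_integrable_mult_right set_integral_diff impI i)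
      show "(LINT t:{0<..<T}|lebesgue. h x t) = Q x"
        unfolding * Q_def trunc_laplace_def
        by (subst set_integral_mult_right, subst set_integral_diff(2)) (use i in auto)
    qed
    have mlim: "((\<lambda>t. m t) \<longlongrightarrow> m s) F" if "L1_limit (\<lambda>t x. u x t) (\<lambda>x. u x s) {0<..<a} F" for s F
      unfolding m_def
    proof (rule L1_limit_weighted[OF that])
      fix y assume "y \<in> {0<..<a}"
      thus "norm ((indicator {\<alpha>..\<beta>} y :: complex) * exp (z * complex_of_real y)) \<le> exp (\<bar>Re z\<bar> * a)"
        using exp_bounded_on_interval[of y a "- z"] by (auto simp: indicator_def)
    qed (use exp_measurable[of "- z"] in \<open>auto\<close>)
    have meq: "m t = (LINT x:{\<alpha>..\<beta>}|lebesgue. exp (z * of_real x) * of_real (u x t))" for t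
      unfolding m_def set_lebesgue_integral_def
      by (intro Bochner_Integration.integral_cong) (use ab in \<open>auto simp: indicator_def\<close>)
    define G where "G t = exp (- (z\<^sup>2) * of_real t) * m t" for t
    have "(LINT t:{0<..<T}|lebesgue. h \<beta> t - h \<alpha> t) = exp (- (z\<^sup>2) * of_real T) * m T - exp (- (z\<^sup>2) * of_real 0) * m 0"
    proof (rule open_interval_integral_eqI[OF T, where P = "\<lambda>_. True" and R = "\<lambda>_. True" and Q = G])
      show "set_integrable lebesgue {0<..<T} (\<lambda>t. h \<beta> t - h \<alpha> t)"
        using hi(1) ab by auto
      show "(G \<longlongrightarrow> exp (- (z\<^sup>2) * of_real 0) * m 0) (at_right 0)"
        unfolding G_def by (intro tendsto_intros mlim tr)
      show "(G \<longlongrightarrow> exp (- (z\<^sup>2) * of_real T) * m T) (at_left T)"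
        unfolding G_def by (intro tendsto_intros mlim tr)
    next
      have dG: "(G has_vector_derivative h \<beta> t - h \<alpha> t) (at t)" if t: "t \<in> {0<..<T}" for t
      proof (rule has_vector_derivative_transform_within_open[OF _ open_greaterThanLessThan t])
        show "((\<lambda>t. integral {\<alpha>..\<beta>} (\<lambda>x. exp (- (z\<^sup>2) * of_real t) * (exp (z * of_real x) * of_real (u x t))))
          has_vector_derivative (h \<beta> t - h \<alpha> t)) (at t)"
          unfolding h_def
          by (rule heat_weighted_mass_derivative[OF ab(3-5) t cu cut d])
      next
        fix s assume s: "s \<in> {0<..<T}"
        have "continuous_on {\<alpha>..\<beta>} (\<lambda>x. exp (z * of_real x) * of_real (u x s))"
          by (intro continuous_intros continuous_on_compose2[OF cu, where f = "\<lambda>x. (x, s)", simplified])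
             (use ab s in auto)
        from set_lebesgue_integral_eq_integral(2)[OF absolutely_integrable_continuous_real[OF this]]
        show "integral {\<alpha>..\<beta>} (\<lambda>x. exp (- (z\<^sup>2) * of_real s) * (exp (z * of_real x) * of_real (u x s))) = G s"
          by (simp add: G_def meq)
      qed
      fix s r assume sr: "0 < s" "s \<le> r" "r < T"
      have "((\<lambda>t. h \<beta> t - h \<alpha> t) has_integral G r - G s) {s..r}"
        by (rule fundamental_theorem_of_calculus[OF sr(2)])
           (use sr in \<open>auto intro!: has_vector_derivative_at_within[OF dG]\<close>)
      moreover have "set_integrable lebesgue {s..r} (\<lambda>t. h \<beta> t - h \<alpha> t)"
        by (rule set_integrable_subset[of _ "{0<..<T}"]) (use hi(1) ab sr in auto)
      ultimately show "(LINT t:{s..r}|lebesgue. h \<beta> t - h \<alpha> t) = G r - G s"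
        by (simp add: set_lebesgue_integral_eq_integral integral_unique)
    qed auto
    moreover have "(LINT t:{0<..<T}|lebesgue. h \<beta> t - h \<alpha> t) = Q \<beta> - Q \<alpha>"
      using hi ab by simp
    moreover have "(LINT x:{\<alpha>..\<beta>}|lebesgue. k x) = exp (- (z\<^sup>2) * of_real T) * m T - m 0"
    proof -
      have "set_integrable lebesgue {\<alpha>..\<beta>} (\<lambda>x. exp (z * of_real x) * of_real (u x T))"
           "set_integrable lebesgue {\<alpha>..\<beta>} (\<lambda>x. exp (z * of_real x) * of_real (u x 0))"
        by (rule set_integrable_subset[OF ui(1)] set_integrable_subset[OF ui(2)]; use ab in auto)+
      thus ?thesis unfolding k_def meq by (subst set_integral_diff(2)) auto
    qed
    ultimately show "(LINT x:{\<alpha>..\<beta>}|lebesgue. k x) = Q \<beta> - Q \<alpha>" by simp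
  qed
  moreover have "(LINT x:{0<..<a}|lebesgue. k x)
      = exp (- (z\<^sup>2) * of_real T) * trunc_laplace a (- z) (\<lambda>x. u x T) - trunc_laplace a (- z) (\<lambda>x. u x 0)"
    unfolding k_def trunc_laplace_def using ui by (subst set_integral_diff(2)) auto
  ultimately show ?thesis by (simp add: Q_def)
qed

text \<open>
  Green's identity holds for \<open>z\<close> and for \<open>- z\<close>, both of which belong to the same \<open>z\<^sup>2\<close>.  With zero
  flux at \<open>a\<close> and zero initial state these are two equations for the transforms of \<open>u 0\<close> and \<open>u a\<close>;
  eliminating the latter expresses the noise-free indicator through the transform of the flux at 0
  and the final state.
\<close>
lemma insulated_heat_boundary_combination:
  fixes z :: complex
  assumes a: "0 < a" and T: "0 < T" and heat: "heat_solution a T u ux"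
    and ins: "\<And>t. t \<in> {0<..<T} \<Longrightarrow> ux a t = 0"
    and init: "\<And>x. x \<in> {0<..<a} \<Longrightarrow> u x 0 = 0"
  defines "R \<equiv> \<lambda>w. exp (- (z\<^sup>2) * of_real T) * trunc_laplace a (- w) (\<lambda>x. u x T)"
  shows "(1 - exp (2 * of_real a * z)) * (trunc_laplace T (z\<^sup>2) (ux 0) - z * trunc_laplace T (z\<^sup>2) (u 0))
       = - 2 * exp (2 * of_real a * z) * trunc_laplace T (z\<^sup>2) (ux 0) - R z - exp (2 * of_real a * z) * R (- z)"
proof -
  let ?F = "trunc_laplace T (z\<^sup>2) (ux 0)" and ?U = "trunc_laplace T (z\<^sup>2) (u 0)"
    and ?W = "trunc_laplace T (z\<^sup>2) (u a)" and ?e = "exp (z * of_real a)"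
  have zero: "trunc_laplace T (z\<^sup>2) (ux a) = 0" "trunc_laplace a w (\<lambda>x. u x 0) = 0" for w
  proof -
    have "trunc_laplace T (z\<^sup>2) (ux a) = (LINT t:{0<..<T}|lebesgue. 0)"
      unfolding trunc_laplace_def by (rule set_lebesgue_integral_cong) (use ins in auto)
    thus "trunc_laplace T (z\<^sup>2) (ux a) = 0" by simp
    have "trunc_laplace a w (\<lambda>x. u x 0) = (LINT t:{0<..<a}|lebesgue. 0)"
      unfolding trunc_laplace_def by (rule set_lebesgue_integral_cong) (use init in auto)
    thus "trunc_laplace a w (\<lambda>x. u x 0) = 0" by simp
  qed
  have 1: "- ?e * (z * ?W) - (?F - z * ?U) = R z"
    using heat_green_identity[OF a T heat, of z] by (simp add: zero R_def)
  have 2: "exp (- z * of_real a) * (z * ?W) - (?F + z * ?U) = R (- z)"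
    using heat_green_identity[OF a T heat, of "- z"] by (simp add: zero R_def)
  have e: "?e * exp (- z * of_real a) = 1" "exp (2 * of_real a * z) = ?e * ?e"
    by (simp_all add: exp_minus flip: exp_add) (simp add: algebra_simps)
  have "?e * ?e * R (- z) = ?e * (?e * exp (- z * of_real a)) * (z * ?W) - ?e * ?e * (?F + z * ?U)"
    unfolding 2[symmetric] by (simp add: algebra_simps)
  also have "\<dots> = ?e * (z * ?W) - ?e * ?e * (?F + z * ?U)" unfolding e by simp
  finally show ?thesis unfolding e 1[symmetric] by (simp add: algebra_simps)
qed

section \<open>Transforms of functions that are polynomial near zero\<close>

lemma exp_decay_beats_power:
  fixes s \<epsilon> N :: real
  assumes "0 < s" "0 < \<epsilon>"
  shows "\<forall>\<^sub>F \<tau> in at_top. N * exp (- (s * \<tau>)) \<le> \<epsilon> / \<tau> ^ m"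
proof -
  have "((\<lambda>\<tau>. N * \<tau> ^ m * exp (- (s * \<tau>))) \<longlongrightarrow> 0) at_top"
    using assms by real_asymp
  hence "\<forall>\<^sub>F \<tau> in at_top. N * \<tau> ^ m * exp (- (s * \<tau>)) < \<epsilon>"
    using assms(2) by (rule order_tendstoD)
  with eventually_gt_at_top[of 0] show ?thesis
    by eventually_elim (simp add: field_simps)
qed

lemma trunc_laplace_continuous:
  assumes f: "continuous_on {0..S} f"
  shows "trunc_laplace S \<omega> f = integral {0..S} (\<lambda>t. exp (- \<omega> * of_real t) * of_real (f t))"
proof -
  have "(\<lambda>t. exp (- \<omega> * of_real t) * of_real (f t)) absolutely_integrable_on {0..S}"
    by (intro absolutely_integrable_continuous_real continuous_intros f)
  hence "set_integrable lebesgue {0<..<S} (\<lambda>t. exp (- \<omega> * of_real t) * of_real (f t))"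
    by (rule set_integrable_subset) auto
  thus ?thesis
    unfolding trunc_laplace_def
    by (simp add: set_lebesgue_integral_eq_integral integral_open_interval_real)
qed

lemma trunc_laplace_poly_by_parts:
  assumes "0 \<le> S"
  shows "\<omega> * trunc_laplace S \<omega> (poly p)
       = of_real (poly p 0) - exp (- \<omega> * of_real S) * of_real (poly p S) + trunc_laplace S \<omega> (poly (pderiv p))"
proof -
  let ?e = "\<lambda>t::real. exp (- \<omega> * of_real t)"
  have dp: "((\<lambda>t. complex_of_real (poly p t)) has_vector_derivative of_real (poly (pderiv p) t)) (at t)" for t
    by (rule has_vector_derivative_of_real)
       (use poly_DERIV[of p t] in \<open>simp add: has_real_derivative_iff_has_vector_derivative\<close>)
  have de: "(?e has_vector_derivative - \<omega> * ?e t) (at t)" for t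
    by (auto intro!: derivative_eq_intros has_vector_derivative_real_field)
  have "((\<lambda>t. ?e t * of_real (poly (pderiv p) t) - \<omega> * (?e t * of_real (poly p t)))
      has_integral ?e S * of_real (poly p S) - ?e 0 * of_real (poly p 0)) {0..S}"
  proof (rule fundamental_theorem_of_calculus[OF assms])
    fix t :: real
    have "((\<lambda>t. ?e t * of_real (poly p t)) has_vector_derivative
       ?e t * of_real (poly (pderiv p) t) - \<omega> * (?e t * of_real (poly p t))) (at t)"
      using has_vector_derivative_mult[OF de dp] by (simp add: algebra_simps)
    thus "((\<lambda>t. ?e t * of_real (poly p t)) has_vector_derivative
       ?e t * of_real (poly (pderiv p) t) - \<omega> * (?e t * of_real (poly p t))) (at t within {0..S})"
      by (rule has_vector_derivative_at_within)
  qed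
  moreover have "((\<lambda>t. ?e t * of_real (poly (pderiv p) t) - \<omega> * (?e t * of_real (poly p t)))
      has_integral trunc_laplace S \<omega> (poly (pderiv p)) - \<omega> * trunc_laplace S \<omega> (poly p)) {0..S}"
    unfolding trunc_laplace_continuous[OF continuous_on_poly[OF continuous_on_id]]
    by (intro has_integral_diff has_integral_mult_right integrable_integral integrable_continuous_real continuous_intros)
  ultimately have "trunc_laplace S \<omega> (poly (pderiv p)) - \<omega> * trunc_laplace S \<omega> (poly p)
      = ?e S * of_real (poly p S) - ?e 0 * of_real (poly p 0)"
    by (rule has_integral_unique[rotated])
  thus ?thesis by (simp add: algebra_simps)
qed

lemma norm_trunc_laplace_continuous_le:
  assumes f: "continuous_on {0..S} f" and B: "\<And>t. t \<in> {0..S} \<Longrightarrow> \<bar>f t\<bar> \<le> B"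
    and S: "0 \<le> S" and \<omega>: "Re \<omega> > 0"
  shows "norm (trunc_laplace S \<omega> f) \<le> B / Re \<omega>"
proof -
  have "((\<lambda>t. B * exp (- Re \<omega> * t)) has_integral
       (- B / Re \<omega> * exp (- Re \<omega> * S)) - (- B / Re \<omega> * exp (- Re \<omega> * 0))) {0..S}"
    by (rule fundamental_theorem_of_calculus[OF S])
       (use \<omega> in \<open>auto intro!: derivative_eq_intros simp flip: has_real_derivative_iff_has_vector_derivative\<close>)
  hence hi: "((\<lambda>t. B * exp (- Re \<omega> * t)) has_integral (B / Re \<omega> - B / Re \<omega> * exp (- Re \<omega> * S))) {0..S}"
    by simp
  have "B \<ge> 0" using B[of 0] S by auto
  have "norm (trunc_laplace S \<omega> f) \<le> integral {0..S} (\<lambda>t. B * exp (- Re \<omega> * t))"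
    unfolding trunc_laplace_continuous[OF f]
  proof (rule Henstock_Kurzweil_Integration.integral_norm_bound_integral)
    show "(\<lambda>t. exp (- \<omega> * of_real t) * of_real (f t)) integrable_on {0..S}"
      by (intro integrable_continuous_real continuous_intros f)
    show "(\<lambda>t. B * exp (- Re \<omega> * t)) integrable_on {0..S}" using hi by blast
    show "norm (exp (- \<omega> * complex_of_real t) * complex_of_real (f t)) \<le> B * exp (- Re \<omega> * t)"
      if "t \<in> {0..S}" for t
      using B[OF that] by (simp add: norm_mult norm_exp_eq_Re mult.commute mult_right_mono)
  qed
  also have "\<dots> \<le> B / Re \<omega>" unfolding integral_unique[OF hi] using \<open>B \<ge> 0\<close> \<omega> by simp
  finally show ?thesis .
qed

text \<open>
  Each integration by parts gains a factor \<open>1 / \<omega>\<close> and brings out the value of the current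
  derivative at 0, up to an exponentially small term from the other end.  The first of \<open>p\<close>, \<open>p'\<close>,
  \<open>p''\<close>, ... that does not vanish at 0 therefore dominates, and it exists because \<open>p \<noteq> 0\<close>.  As \<open>|\<omega>|\<close> grows
  at most quadratically, the loss is a power of \<open>\<tau>\<close>.  The induction is on the degree of \<open>p\<close>.
\<close>
lemma trunc_laplace_poly_lower_bound:
  fixes \<omega> :: "real \<Rightarrow> complex"
  assumes S: "0 < S" and K: "0 < K" and Re: "\<forall>\<^sub>F \<tau> in at_top. Re (\<omega> \<tau>) = \<tau>"
    and grow: "\<forall>\<^sub>F \<tau> in at_top. norm (\<omega> \<tau>) \<le> K * \<tau>\<^sup>2"
    and "p \<noteq> 0"
  shows "\<exists>C>0. \<exists>m. \<forall>\<^sub>F \<tau> in at_top. C / \<tau> ^ m \<le> norm (trunc_laplace S (\<omega> \<tau>) (poly p))"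
  using \<open>p \<noteq> 0\<close>
proof (induction "degree p" arbitrary: p rule: less_induct)
  case less
  let ?X = "\<lambda>\<tau>. norm (trunc_laplace S (\<omega> \<tau>) (poly (pderiv p)))"
  have ev: "\<forall>\<^sub>F \<tau> in at_top. 0 < \<tau> \<and> Re (\<omega> \<tau>) = \<tau> \<and> norm (\<omega> \<tau>) \<le> K * \<tau>\<^sup>2"
    using eventually_gt_at_top[of 0] Re grow by eventually_elim auto
  \<comment> \<open>Undoing the factor \<omega> of one integration by parts raises the exponent by 2.\<close>
  have main: "\<exists>C>0. \<exists>m. \<forall>\<^sub>F \<tau> in at_top. C / \<tau> ^ m \<le> norm (trunc_laplace S (\<omega> \<tau>) (poly p))"
    if C: "0 < C" and lb: "\<forall>\<^sub>F \<tau> in at_top. C / \<tau> ^ m \<le> norm (\<omega> \<tau> * trunc_laplace S (\<omega> \<tau>) (poly p))" for C m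
  proof (intro exI[of _ "C / K"] exI[of _ "m + 2"] conjI)
    show "\<forall>\<^sub>F \<tau> in at_top. C / K / \<tau> ^ (m + 2) \<le> norm (trunc_laplace S (\<omega> \<tau>) (poly p))"
      using lb ev
    proof eventually_elim
      case (elim \<tau>)
      have "C / \<tau> ^ m \<le> norm (\<omega> \<tau>) * norm (trunc_laplace S (\<omega> \<tau>) (poly p))"
        using elim by (simp add: norm_mult)
      also have "\<dots> \<le> K * \<tau>\<^sup>2 * norm (trunc_laplace S (\<omega> \<tau>) (poly p))"
        using elim by (intro mult_right_mono) auto
      finally show ?case using elim K by (simp add: field_simps power_add power2_eq_square)
    qed
  qed (use C K in auto)
  have norm_e: "norm (exp (- \<omega> \<tau> * of_real S) * of_real (poly p S)) = \<bar>poly p S\<bar> * exp (- (S * \<tau>))"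
    if "Re (\<omega> \<tau>) = \<tau>" for \<tau>
    using that by (simp add: norm_mult norm_exp_eq_Re mult.commute)
  show ?case
  proof (cases "poly p 0 = 0")
    case True
    have "degree p \<noteq> 0"
      using True less.prems by (metis degree_0_id poly_0_coeff_0 pCons_0_0 degree_eq_zeroE poly_pCons mult_zero_left add.right_neutral pCons_eq_0_iff)
    hence "degree (pderiv p) < degree p" "pderiv p \<noteq> 0"
      by (auto simp: degree_pderiv pderiv_eq_0_iff)
    from less.hyps[OF this] obtain C m where C: "0 < C"
      and lb: "\<forall>\<^sub>F \<tau> in at_top. C / \<tau> ^ m \<le> ?X \<tau>" by auto
    have "\<forall>\<^sub>F \<tau> in at_top. (C/2) / \<tau> ^ m \<le> norm (\<omega> \<tau> * trunc_laplace S (\<omega> \<tau>) (poly p))"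
      using lb ev exp_decay_beats_power[OF S half_gt_zero[OF C], of "\<bar>poly p S\<bar>" m]
    proof eventually_elim
      case (elim \<tau>)
      have "?X \<tau> - norm (exp (- \<omega> \<tau> * of_real S) * of_real (poly p S)) \<le> norm (\<omega> \<tau> * trunc_laplace S (\<omega> \<tau>) (poly p))"
        unfolding trunc_laplace_poly_by_parts[OF less_imp_le[OF S]] True
        using norm_triangle_ineq2[of "trunc_laplace S (\<omega> \<tau>) (poly (pderiv p))" "exp (- \<omega> \<tau> * of_real S) * of_real (poly p S)"]
        by simp
      thus ?case using elim norm_e[of \<tau>] by simp
    qed
    thus ?thesis by (rule main[rotated]) (use C in simp)
  next
    case False
    have "\<exists>B. \<forall>t\<in>{0..S}. \<bar>poly (pderiv p) t\<bar> \<le> B"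
      using compact_imp_bounded[OF compact_continuous_image[OF continuous_on_poly[OF continuous_on_id, of "{0..S}" "pderiv p"] compact_Icc]]
      by (auto simp: bounded_iff)
    then obtain B where B: "\<And>t. t \<in> {0..S} \<Longrightarrow> \<bar>poly (pderiv p) t\<bar> \<le> B" by blast
    \<comment> \<open>A quarter of |p(0)| for each of the two error terms and for the remaining lower bound.\<close>
    let ?C = "\<bar>poly p 0\<bar> / 4"
    have C: "0 < ?C" using False by simp
    have "((\<lambda>\<tau>::real. B / \<tau>) \<longlongrightarrow> 0) at_top" by real_asymp
    from order_tendstoD(2)[OF this C] have "\<forall>\<^sub>F \<tau> in at_top. B / \<tau> < ?C" .
    hence "\<forall>\<^sub>F \<tau> in at_top. ?C / \<tau> ^ 0 \<le> norm (\<omega> \<tau> * trunc_laplace S (\<omega> \<tau>) (poly p))"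
      using ev exp_decay_beats_power[OF S C, of "\<bar>poly p S\<bar>" 0]
    proof eventually_elim
      case (elim \<tau>)
      let ?x = "complex_of_real (poly p 0)" and ?y = "exp (- \<omega> \<tau> * of_real S) * of_real (poly p S)"
        and ?w = "trunc_laplace S (\<omega> \<tau>) (poly (pderiv p))"
      have "norm ?w \<le> B / Re (\<omega> \<tau>)"
        by (rule norm_trunc_laplace_continuous_le[OF continuous_on_poly[OF continuous_on_id] B])
           (use elim S in auto)
      hence "norm ?w \<le> B / \<tau>" using elim by simp
      hence "norm ?w \<le> ?C" using elim(1) by linarith
      moreover have "norm ?y \<le> ?C" using elim norm_e[of \<tau>] by simp
      moreover have "norm ?x \<le> norm (?x - ?y + ?w) + norm ?y + norm ?w"
        using norm_triangle_ineq4[of "?x - ?y + ?w" "?w - ?y"] norm_triangle_ineq4[of ?w ?y] by simp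
      ultimately show ?case
        unfolding trunc_laplace_poly_by_parts[OF less_imp_le[OF S]] using C by simp
    qed
    thus ?thesis by (rule main[rotated]) (use C in simp)
  qed
qed

text \<open>
  Only the behaviour near time 0 matters for the transform, up to an exponentially small error.
\<close>
lemma trunc_laplace_tail:
  assumes f: "set_integrable lebesgue {0<..<T} f" and S: "S \<le> T" "0 < S"
    and fg: "\<And>t. t \<in> {0<..<S} \<Longrightarrow> f t = g t" and \<omega>: "0 \<le> Re \<omega>"
  shows "norm (trunc_laplace T \<omega> f - trunc_laplace S \<omega> g) \<le> exp (- (S * Re \<omega>)) * (LINT t:{0<..<T}|lebesgue. \<bar>f t\<bar>)"
proof -
  let ?e = "\<lambda>t::real. exp (- \<omega> * of_real t)"
  \<comment> \<open>The transform of g is that of f with the weight cut off at S, so the difference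
     carries the complementary weight, which is at most exp (- S Re \<omega>).\<close>
  let ?\<phi> = "\<lambda>t. indicator {S..} t * ?e t" and ?\<psi> = "\<lambda>t. indicator {..<S} t * ?e t"
  have b: "norm (?e t) \<le> 1" if "t \<in> {0<..<T}" for t
    using that \<omega> by (auto simp: norm_exp_eq_Re)
  have m: "?\<phi> \<in> borel_measurable borel" "?\<psi> \<in> borel_measurable borel"
    using exp_measurable[of \<omega>] by auto
  have i: "set_integrable lebesgue {0<..<T} (\<lambda>t. ?\<psi> t * of_real (f t))"
    by (rule set_integral_bounded_mult(1)[OF f _ m(2), of 1]) (use b in \<open>auto simp: indicator_def\<close>)
  have "trunc_laplace S \<omega> g = (LINT t:{0<..<T}|lebesgue. ?\<psi> t * of_real (f t))"
    unfolding trunc_laplace_def set_lebesgue_integral_def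
    by (intro Bochner_Integration.integral_cong) (use S fg in \<open>auto simp: indicator_def\<close>)
  hence "trunc_laplace T \<omega> f - trunc_laplace S \<omega> g
      = (LINT t:{0<..<T}|lebesgue. ?e t * of_real (f t) - ?\<psi> t * of_real (f t))"
    using trunc_laplace_integrable[OF f, of \<omega>] i
    by (simp add: trunc_laplace_def set_integral_diff(2))
  also have "\<dots> = (LINT t:{0<..<T}|lebesgue. ?\<phi> t * of_real (f t))"
    unfolding set_lebesgue_integral_def
    by (intro Bochner_Integration.integral_cong) (auto simp: indicator_def)
  also have "norm \<dots> \<le> exp (- (S * Re \<omega>)) * (LINT t:{0<..<T}|lebesgue. \<bar>f t\<bar>)"
    by (rule set_integral_bounded_mult(2)[OF f _ m(1)])
       (use \<omega> in \<open>auto simp: indicator_def norm_exp_eq_Re mult.commute intro: mult_right_mono\<close>)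
  finally show ?thesis .
qed

section \<open>The indicator and its noise\<close>

lemma Re_zfreq: "Re (zfreq c \<tau>) = - (c * \<tau>)"
  by (simp add: zfreq_def)

text \<open>
  The square root in the definition of \<open>z\<close> is chosen so that \<open>Re (z\<^sup>2) = \<tau>\<close> exactly; the threshold
  on \<open>\<tau>\<close> makes its radicand nonnegative.
\<close>
lemma Re_zfreq_sq:
  assumes "0 < c" "1 / c\<^sup>2 \<le> \<tau>"
  shows "Re ((zfreq c \<tau>)\<^sup>2) = \<tau>"
proof -
  have "0 < \<tau>" using assms by (meson divide_pos_pos less_le_trans zero_less_one zero_less_power)
  hence "1 / (c\<^sup>2 * \<tau>) \<le> 1" using assms by (simp add: field_simps)
  thus ?thesis using assms \<open>0 < \<tau>\<close>
    by (simp add: zfreq_def power2_eq_square[of "Complex _ _"] power_mult_distrib Re_power2 field_simps)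
       (simp add: power2_eq_square)
qed

lemma norm_zfreq_le:
  assumes "0 < c" "1 / c\<^sup>2 \<le> \<tau>"
  shows "norm (zfreq c \<tau>) \<le> 2 * c * \<tau>"
proof -
  have \<tau>: "0 < \<tau>" using assms by (meson divide_pos_pos less_le_trans zero_less_one zero_less_power)
  let ?s = "sqrt (1 - 1 / (c\<^sup>2 * \<tau>))"
  have "1 / (c\<^sup>2 * \<tau>) \<le> 1" using assms \<tau> by (simp add: field_simps)
  hence s: "\<bar>?s\<bar> \<le> 1" using assms \<tau> by simp
  have "norm (1 + \<i> * complex_of_real ?s) \<le> norm (1::complex) + norm (\<i> * complex_of_real ?s)"
    by (rule norm_triangle_ineq)
  also have "\<dots> \<le> 2" using s by (simp add: norm_mult)
  finally have "norm (1 + \<i> * complex_of_real ?s) \<le> 2" .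
  hence "c * \<tau> * norm (1 + \<i> * complex_of_real ?s) \<le> c * \<tau> * 2"
    using assms \<tau> by (intro mult_left_mono) auto
  thus ?thesis using assms \<tau> by (simp add: zfreq_def norm_mult mult_ac)
qed

text \<open>
  Integrating \<open>|E| \<le> \<delta> / 2 + E\<^sup>2 / (2 \<delta>)\<close> gives an \<open>L1\<close> bound that is linear in the \<open>L2\<close> bound.
\<close>
lemma square_integrable_L1:
  assumes T: "0 < T" and E: "square_integrable T E" and \<delta>: "0 < \<delta>" "L2_norm T E \<le> \<delta>"
  shows "set_integrable lebesgue {0<..<T} E"
    and "(LINT t:{0<..<T}|lebesgue. \<bar>E t\<bar>) \<le> (T + 1) / 2 * \<delta>"
proof -
  have sq: "set_integrable lebesgue {0<..<T} (\<lambda>t. (E t)\<^sup>2)"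
    and meas: "set_borel_measurable lebesgue {0<..<T} E"
    using E by (auto simp: square_integrable_def)
  have const: "set_integrable lebesgue {0<..<T} (\<lambda>t. \<delta> / 2)"
    using absolutely_integrable_on_const[of "{0<..<T}" "\<delta>/2"] by simp
  have "(\<lambda>t. (E t)\<^sup>2 / (2 * \<delta>)) = (\<lambda>t. 1 / (2 * \<delta>) * (E t)\<^sup>2)" by auto
  hence sq': "set_integrable lebesgue {0<..<T} (\<lambda>t. (E t)\<^sup>2 / (2 * \<delta>))" using sq by simp
  let ?b = "\<lambda>t. \<delta> / 2 + (E t)\<^sup>2 / (2 * \<delta>)"
  have bi: "set_integrable lebesgue {0<..<T} ?b" using const sq' by (rule set_integral_add)
  have le: "\<bar>E t\<bar> \<le> ?b t" for t
  proof -
    have "0 \<le> (\<delta> - \<bar>E t\<bar>)\<^sup>2" by simp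
    thus ?thesis using \<delta> by (simp add: field_simps power2_eq_square abs_mult_self_eq)
  qed
  show Ei: "set_integrable lebesgue {0<..<T} E"
    by (rule set_integrable_bound[OF bi meas]) (use order_trans[OF le abs_ge_self] in auto)
  have nn: "0 \<le> (LINT t:{0<..<T}|lebesgue. (E t)\<^sup>2)"
    by (auto simp: set_lebesgue_integral_def intro!: integral_nonneg_AE)
  have "(LINT t:{0<..<T}|lebesgue. (E t)\<^sup>2) = (L2_norm T E)\<^sup>2"
    using nn by (simp add: L2_norm_def)
  also have "\<dots> \<le> \<delta>\<^sup>2" using \<delta> nn by (intro power_mono) (auto simp: L2_norm_def)
  finally have sqle: "(LINT t:{0<..<T}|lebesgue. (E t)\<^sup>2) \<le> \<delta>\<^sup>2" .
  have "(LINT t:{0<..<T}|lebesgue. \<bar>E t\<bar>) \<le> (LINT t:{0<..<T}|lebesgue. ?b t)"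
    by (rule set_integral_mono[OF set_integrable_abs[OF Ei] bi le])
  also have "\<dots> = (LINT t:{0<..<T}|lebesgue. \<delta> / 2) + (LINT t:{0<..<T}|lebesgue. (E t)\<^sup>2 / (2 * \<delta>))"
    using const sq' by (rule set_integral_add)
  also have "(LINT t:{0<..<T}|lebesgue. \<delta> / 2) = T * \<delta> / 2"
    unfolding set_lebesgue_integral_eq_integral(2)[OF const] integral_open_interval_real[symmetric] using T by simp
  also have "(LINT t:{0<..<T}|lebesgue. (E t)\<^sup>2 / (2 * \<delta>)) = (LINT t:{0<..<T}|lebesgue. (E t)\<^sup>2) / (2 * \<delta>)"
    by simp
  also have "\<dots> \<le> \<delta>\<^sup>2 / (2 * \<delta>)" using sqle \<delta> by (intro divide_right_mono) auto
  finally show "(LINT t:{0<..<T}|lebesgue. \<bar>E t\<bar>) \<le> (T + 1) / 2 * \<delta>"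
    using \<delta> by (simp add: field_simps power2_eq_square)
qed

lemma I_c_eq_trunc_laplace:
  fixes c \<tau> :: real
  assumes u: "set_integrable lebesgue {0<..<T} (u 0)" "set_integrable lebesgue {0<..<T} (ux 0)"
    and E: "set_integrable lebesgue {0<..<T} E1" "set_integrable lebesgue {0<..<T} E2"
  defines "z \<equiv> zfreq c \<tau>"
  shows "I_c T u ux c \<tau> E1 E2
       = (trunc_laplace T (z\<^sup>2) (ux 0) - z * trunc_laplace T (z\<^sup>2) (u 0))
         + (trunc_laplace T (z\<^sup>2) E2 - z * trunc_laplace T (z\<^sup>2) E1)"
proof -
  have v0: "vsol c \<tau> 0 t = exp (- (z\<^sup>2) * of_real t)" for t
    by (simp add: vsol_def z_def)
  have vx: "vsol_x c \<tau> 0 t = z * exp (- (z\<^sup>2) * of_real t)" for t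
  proof -
    have "((\<lambda>y::real. exp (- (z\<^sup>2) * of_real t) * exp (of_real y * z)) has_vector_derivative
          z * exp (- (z\<^sup>2) * of_real t)) (at 0)"
      by (auto intro!: derivative_eq_intros has_vector_derivative_real_field)
    thus ?thesis unfolding vsol_x_def vsol_def z_def[symmetric] by (rule vector_derivative_at)
  qed
  let ?e = "\<lambda>t::real. exp (- (z\<^sup>2) * of_real t)"
  have i: "set_integrable lebesgue {0<..<T} (\<lambda>t. ?e t * of_real (u 0 t))"
    "set_integrable lebesgue {0<..<T} (\<lambda>t. ?e t * of_real (ux 0 t))"
    "set_integrable lebesgue {0<..<T} (\<lambda>t. ?e t * of_real (E1 t))"
    "set_integrable lebesgue {0<..<T} (\<lambda>t. ?e t * of_real (E2 t))"
    by (intro trunc_laplace_integrable u E)+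
  have "I_c T u ux c \<tau> E1 E2 = (LINT t:{0<..<T}|lebesgue. (?e t * of_real (ux 0 t) - z * (?e t * of_real (u 0 t)))
         + (?e t * of_real (E2 t) - z * (?e t * of_real (E1 t))))"
    unfolding I_c_def v0 vx by (simp add: algebra_simps)
  also have "\<dots> = (LINT t:{0<..<T}|lebesgue. ?e t * of_real (ux 0 t) - z * (?e t * of_real (u 0 t)))
     + (LINT t:{0<..<T}|lebesgue. ?e t * of_real (E2 t) - z * (?e t * of_real (E1 t)))"
    by (intro set_integral_add set_integral_diff set_integrable_mult_right impI i)
  also have "\<dots> = (trunc_laplace T (z\<^sup>2) (ux 0) - z * trunc_laplace T (z\<^sup>2) (u 0))
         + (trunc_laplace T (z\<^sup>2) E2 - z * trunc_laplace T (z\<^sup>2) E1)"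
    unfolding trunc_laplace_def
    by (subst (1 2) set_integral_diff(2)) (use i in auto)
  finally show ?thesis .
qed

section \<open>Two-sided bound for the indicator\<close>

text \<open>
  The main term \<open>2 g f\<close> has at least twice the size allowed for the remainder \<open>r\<close>, so \<open>r\<close> cannot
  cancel it, and \<open>1 - g\<close> stays away from 0 and infinity.
\<close>
lemma dominant_term_bounds:
  fixes g I f r :: complex
  assumes eq: "(1 - g) * I = - (2 * g * f) + r"
    and g: "norm g \<le> 1 / 2" and r: "norm r \<le> norm g * d" and d: "d \<le> norm f"
  shows "norm g * d / 2 \<le> norm I" and "norm I \<le> norm g * (4 * norm f + 2 * d)"
proof -
  have 1: "1 / 2 \<le> norm (1 - g)" "norm (1 - g) \<le> 2"
    using norm_triangle_ineq2[of 1 g] norm_triangle_ineq4[of 1 g] g by auto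
  have 2: "norm (1 - g) * norm I = norm (- (2 * g * f) + r)"
    using eq by (simp flip: norm_mult)
  have 3: "norm (2 * g * f) = 2 * (norm g * norm f)" by (simp add: norm_mult)
  have 4: "norm g * d \<le> norm g * norm f" using d by (rule mult_left_mono) simp
  have "2 * (norm g * norm f) - norm r \<le> norm (- (2 * g * f) + r)"
    using norm_triangle_ineq2[of "2 * g * f" r] norm_minus_commute[of "2 * g * f" r]
    by (simp add: 3)
  hence "norm g * d \<le> norm (1 - g) * norm I" using r 4 unfolding 2 by linarith
  also have "\<dots> \<le> 2 * norm I" using 1 by (intro mult_right_mono) auto
  finally show "norm g * d / 2 \<le> norm I" by simp
  have "norm (- (2 * g * f) + r) \<le> 2 * (norm g * norm f) + norm r"
    using norm_triangle_ineq[of "- (2 * g * f)" r] by (simp only: norm_minus_cancel 3)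
  moreover have "1 / 2 * norm I \<le> norm (1 - g) * norm I" using 1 by (intro mult_right_mono) auto
  ultimately have "norm I \<le> 4 * (norm g * norm f) + 2 * (norm g * d)" using r unfolding 2 by linarith
  thus "norm I \<le> norm g * (4 * norm f + 2 * d)" by (simp add: algebra_simps)
qed

text \<open>
  After multiplication of the indicator by \<open>1 - exp (2 a z)\<close>, which tends to 1, every contribution
  other than \<open>- 2 exp (2 a z) F\<close>, where \<open>F\<close> is the transform of the flux at 0, is
  \<open>O(\<tau> exp (- T \<tau>))\<close>: the final state by the factor \<open>exp (- z\<^sup>2 T)\<close>, and the noise by the radius
  of the ball.  Since \<open>|exp (2 a z)| = exp (- 2 c a \<tau>)\<close> with \<open>2 a c < T\<close>, and \<open>F\<close> is bounded
  above and decays at most like a power of \<open>\<tau>\<close>, the main term wins.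
\<close>
lemma indicator_two_sided_bound:
  assumes a: "0 < a" and T: "0 < T" and heat: "heat_solution a T u ux"
    and ins: "\<And>t. t \<in> {0<..<T} \<Longrightarrow> ux a t = 0"
    and init: "\<And>x. x \<in> {0<..<a} \<Longrightarrow> u x 0 = 0"
    and c: "0 < c" "2 * a * c < T" and S: "0 < S" "S \<le> T"
    and p: "p \<noteq> 0" "\<And>t. t \<in> {0<..<S} \<Longrightarrow> ux 0 t = poly p t"
  shows "\<exists>C1>0. \<exists>C2>0. \<exists>m. \<forall>\<^sub>F \<tau> in at_top. \<forall>(E1, E2) \<in> noise_ball T (exp (- (T * \<tau>))).
           C1 / \<tau> ^ m * exp (- (2 * c * a * \<tau>)) \<le> norm (I_c T u ux c \<tau> E1 E2) \<and>
           norm (I_c T u ux c \<tau> E1 E2) \<le> C2 * exp (- (2 * c * a * \<tau>))"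
proof -
  have int: "set_integrable lebesgue {0<..<T} (u 0)" "set_integrable lebesgue {0<..<T} (ux 0)"
    "set_integrable lebesgue {0<..<a} (\<lambda>x. u x T)"
    using heat by (auto simp: heat_solution_def L1_limit_def)
  define N where "N = (LINT t:{0<..<T}|lebesgue. \<bar>ux 0 t\<bar>)"
  define NT where "NT = (LINT x:{0<..<a}|lebesgue. \<bar>u x T\<bar>)"
  have N: "0 \<le> N" "0 \<le> NT"
    by (auto simp: N_def NT_def set_lebesgue_integral_def intro!: integral_nonneg_AE)
  define z where "z = zfreq c"
  define F where "F \<tau> = trunc_laplace T ((z \<tau>)\<^sup>2) (ux 0)" for \<tau>
  have large: "\<forall>\<^sub>F \<tau> in at_top. 1 \<le> \<tau> \<and> Re ((z \<tau>)\<^sup>2) = \<tau> \<and> norm (z \<tau>) \<le> 2 * c * \<tau>"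
    using eventually_ge_at_top[of 1] eventually_ge_at_top[of "1 / c\<^sup>2"]
    by eventually_elim (use c Re_zfreq_sq norm_zfreq_le in \<open>auto simp: z_def\<close>)
  have grow: "\<forall>\<^sub>F \<tau> in at_top. norm ((z \<tau>)\<^sup>2) \<le> (2 * c)\<^sup>2 * \<tau>\<^sup>2"
    using large
  proof eventually_elim
    case (elim \<tau>)
    hence "(norm (z \<tau>))\<^sup>2 \<le> (2 * c * \<tau>)\<^sup>2" by (intro power_mono) auto
    thus ?case by (simp add: norm_power power_mult_distrib)
  qed
  have "\<forall>\<^sub>F \<tau> in at_top. Re ((z \<tau>)\<^sup>2) = \<tau>" using large by eventually_elim simp
  from trunc_laplace_poly_lower_bound[OF S(1) _ this grow p(1)] c obtain C m where C: "0 < C"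
    and P: "\<forall>\<^sub>F \<tau> in at_top. C / \<tau> ^ m \<le> norm (trunc_laplace S ((z \<tau>)\<^sup>2) (poly p))"
    by auto
  \<comment> \<open>Half of the lower bound for the polynomial part is kept; the other half absorbs
     the flux after time S.\<close>
  define D where "D = C / 2"
  have D: "0 < D" using C by (simp add: D_def)
  have Flow: "\<forall>\<^sub>F \<tau> in at_top. D / \<tau> ^ m \<le> norm (F \<tau>)"
    using P large exp_decay_beats_power[OF S(1) D, of N m]
  proof eventually_elim
    case (elim \<tau>)
    have "norm (F \<tau> - trunc_laplace S ((z \<tau>)\<^sup>2) (poly p)) \<le> exp (- (S * Re ((z \<tau>)\<^sup>2))) * N"
      unfolding F_def N_def by (rule trunc_laplace_tail[OF int(2) S(2,1) p(2)]) (use elim in auto)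
    also have "\<dots> \<le> D / \<tau> ^ m" using elim by (simp add: mult.commute)
    finally have "norm (F \<tau> - trunc_laplace S ((z \<tau>)\<^sup>2) (poly p)) \<le> D / \<tau> ^ m" .
    moreover have "C / \<tau> ^ m = D / \<tau> ^ m + D / \<tau> ^ m" by (simp add: D_def)
    moreover have "norm (trunc_laplace S ((z \<tau>)\<^sup>2) (poly p)) \<le> norm (F \<tau>) + norm (F \<tau> - trunc_laplace S ((z \<tau>)\<^sup>2) (poly p))"
      using norm_triangle_ineq4[of "F \<tau>" "F \<tau> - trunc_laplace S ((z \<tau>)\<^sup>2) (poly p)"] by simp
    ultimately show ?case using elim(1) by linarith
  qed
  define q where "q \<tau> = exp (- (2 * c * a * \<tau>))" for \<tau> :: real
  have "(q \<longlongrightarrow> 0) at_top" unfolding q_def using a c(1) by real_asymp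
  hence qhalf: "\<forall>\<^sub>F \<tau> in at_top. q \<tau> < 1/2" by (rule order_tendstoD) simp
  \<comment> \<open>K \<tau> exp (- T \<tau>) will bound the final state and the noise together.\<close>
  define K where "K = 2 * NT + (2 * c + 1) * (T + 1)"
  have gap: "0 < T - 2 * c * a" using c by (simp add: mult_ac)
  have main: "\<forall>\<^sub>F \<tau> in at_top. \<forall>(E1, E2) \<in> noise_ball T (exp (- (T * \<tau>))).
           D / 2 / \<tau> ^ m * q \<tau> \<le> norm (I_c T u ux c \<tau> E1 E2) \<and>
           norm (I_c T u ux c \<tau> E1 E2) \<le> 2 * (2 * N + D) * q \<tau>"
    using Flow large qhalf exp_decay_beats_power[OF gap D, of K "Suc m"]
  proof eventually_elim
    case (elim \<tau>)
    show ?case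
    proof safe
      fix E1 E2 assume "(E1, E2) \<in> noise_ball T (exp (- (T * \<tau>)))"
      hence E: "square_integrable T E1" "square_integrable T E2"
        and le: "L2_norm T E1 + L2_norm T E2 \<le> exp (- (T * \<tau>))"
        by (auto simp: noise_ball_def)
      have "0 \<le> L2_norm T E1" "0 \<le> L2_norm T E2"
        by (auto simp: L2_norm_def set_lebesgue_integral_def intro!: integral_nonneg_AE)
      with le have le': "L2_norm T E1 \<le> exp (- (T * \<tau>))" "L2_norm T E2 \<le> exp (- (T * \<tau>))" by linarith+
      note E1 = square_integrable_L1[OF T E(1) exp_gt_zero le'(1)]
      note E2 = square_integrable_L1[OF T E(2) exp_gt_zero le'(2)]
      let ?\<delta> = "exp (- (T * \<tau>))" and ?z = "z \<tau>" and ?I = "I_c T u ux c \<tau> E1 E2"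
      have \<tau>: "1 \<le> \<tau>" and Re2: "Re (?z\<^sup>2) = \<tau>" and nz: "norm ?z \<le> 2 * c * \<tau>"
        using elim by auto
      define g where "g = exp (2 * of_real a * ?z)"
      have g: "norm g = q \<tau>"
        by (simp add: g_def q_def z_def norm_exp_eq_Re Re_zfreq mult_ac)
      define R where "R w = exp (- (?z\<^sup>2) * of_real T) * trunc_laplace a (- w) (\<lambda>x. u x T)" for w
      define noise where "noise = trunc_laplace T (?z\<^sup>2) E2 - ?z * trunc_laplace T (?z\<^sup>2) E1"
      have I: "?I = (F \<tau> - ?z * trunc_laplace T (?z\<^sup>2) (u 0)) + noise"
        unfolding noise_def F_def z_def by (rule I_c_eq_trunc_laplace[of T u ux E1 E2, OF int(1,2) E1(1) E2(1)])
      have "(1 - g) * (F \<tau> - ?z * trunc_laplace T (?z\<^sup>2) (u 0)) = - 2 * g * F \<tau> - R ?z - g * R (- ?z)"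
        unfolding g_def F_def R_def by (rule insulated_heat_boundary_combination[OF a T heat ins init])
      hence gI: "(1 - g) * ?I = - (2 * g * F \<tau>) + (- R ?z - g * R (- ?z) + (1 - g) * noise)"
        unfolding I by (simp add: algebra_simps)
      have expT: "norm (exp (- (?z\<^sup>2) * of_real T)) = ?\<delta>"
        using Re2 by (simp add: norm_exp_eq_Re mult.commute)
      have R1: "norm (R ?z) \<le> ?\<delta> * NT"
        unfolding R_def norm_mult expT NT_def
        by (intro mult_left_mono norm_trunc_laplace_le int) (use c \<tau> in \<open>auto simp: z_def Re_zfreq\<close>)
      have R2: "norm (g * R (- ?z)) \<le> ?\<delta> * NT"
      proof -
        have "norm (trunc_laplace a (- (- ?z)) (\<lambda>x. u x T)) \<le> exp (\<bar>Re (- (- ?z))\<bar> * a) * NT"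
          unfolding NT_def by (rule norm_trunc_laplace_le_exp[OF int(3)])
        \<comment> \<open>For - z the spatial weight grows like exp (c a \<tau>), which the prefactor
           exp (- 2 c a \<tau>) more than compensates.\<close>
        also have "\<bar>Re (- (- ?z))\<bar> * a = c * a * \<tau>" using c \<tau> by (simp add: z_def Re_zfreq mult_ac)
        finally have "norm (g * R (- ?z)) \<le> q \<tau> * (?\<delta> * (exp (c * a * \<tau>) * NT))"
          unfolding R_def norm_mult expT g by (auto intro!: mult_left_mono simp: q_def)
        also have "\<dots> = (q \<tau> * exp (c * a * \<tau>)) * (?\<delta> * NT)" by simp
        also have "\<dots> \<le> 1 * (?\<delta> * NT)"
          by (intro mult_right_mono) (use a c \<tau> N in \<open>auto simp: q_def simp flip: exp_add\<close>)
        finally show ?thesis by simp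
      qed
      have nn: "norm noise \<le> (2 * c + 1) * \<tau> * ((T + 1) / 2 * ?\<delta>)"
      proof -
        let ?b = "(T + 1) / 2 * ?\<delta>"
        have l: "norm (trunc_laplace T (?z\<^sup>2) E1) \<le> ?b" "norm (trunc_laplace T (?z\<^sup>2) E2) \<le> ?b"
          using norm_trunc_laplace_le[OF E1(1), of "?z\<^sup>2"] norm_trunc_laplace_le[OF E2(1), of "?z\<^sup>2"]
            E1(2) E2(2) Re2 \<tau> by auto
        have "norm noise \<le> norm (trunc_laplace T (?z\<^sup>2) E2) + norm ?z * norm (trunc_laplace T (?z\<^sup>2) E1)"
          unfolding noise_def by (rule order_trans[OF norm_triangle_ineq4]) (simp add: norm_mult)
        also have "\<dots> \<le> ?b + 2 * c * \<tau> * ?b"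
          by (intro add_mono mult_mono l nz) (use c \<tau> in auto)
        also have "\<dots> \<le> \<tau> * ?b + 2 * c * \<tau> * ?b"
          using \<tau> T mult_right_mono[of 1 \<tau> ?b] by simp
        also have "\<dots> = (2 * c + 1) * \<tau> * ?b" by (simp only: distrib_right mult_1_left add.commute)
        finally show ?thesis .
      qed
      have g1: "norm (1 - g) \<le> 2"
        using norm_triangle_ineq4[of 1 g] elim g by auto
      let ?r = "- R ?z - g * R (- ?z) + (1 - g) * noise"
      have "norm ?r \<le> norm (R ?z) + norm (g * R (- ?z)) + norm (1 - g) * norm noise"
        using norm_triangle_ineq[of "- R ?z - g * R (- ?z)" "(1 - g) * noise"]
          norm_triangle_ineq4[of "- R ?z" "g * R (- ?z)"] by (simp add: norm_mult)
      also have "\<dots> \<le> ?\<delta> * NT + ?\<delta> * NT + 2 * ((2 * c + 1) * \<tau> * ((T + 1) / 2 * ?\<delta>))"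
        by (intro add_mono R1 R2 mult_mono g1 nn) auto
      also have "\<dots> = ?\<delta> * (2 * NT + (2 * c + 1) * (T + 1) * \<tau>)" by (simp add: field_simps)
      also have "\<dots> \<le> ?\<delta> * (K * \<tau>)"
        using \<tau> N mult_left_mono[of 1 \<tau> "2 * NT"] by (intro mult_left_mono) (auto simp: K_def algebra_simps)
      also have "\<dots> = q \<tau> * \<tau> * (K * exp (- ((T - 2 * c * a) * \<tau>)))"
        by (simp add: q_def algebra_simps flip: exp_add)
      also have "\<dots> \<le> q \<tau> * \<tau> * (D / \<tau> ^ Suc m)"
        using elim \<tau> by (intro mult_left_mono) (auto simp: q_def)
      also have "\<dots> = q \<tau> * (D / \<tau> ^ m)" using \<tau> by simp
      finally have r: "norm ?r \<le> q \<tau> * (D / \<tau> ^ m)" .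
      have "norm g \<le> 1 / 2" using elim g by simp
      note bounds = dominant_term_bounds[OF gI this r[folded g] elim(1)]
      show "D / 2 / \<tau> ^ m * q \<tau> \<le> norm ?I" using bounds(1) by (simp add: g mult_ac)
      have Fup: "norm (F \<tau>) \<le> N"
        unfolding F_def N_def by (rule norm_trunc_laplace_le[OF int(2)]) (use Re2 \<tau> in simp)
      have "D / \<tau> ^ m \<le> D" using D \<tau> by (simp add: divide_le_eq mult_le_cancel_left1 one_le_power)
      hence "norm g * (4 * norm (F \<tau>) + 2 * (D / \<tau> ^ m)) \<le> norm g * (4 * N + 2 * D)"
        using Fup by (intro mult_left_mono) auto
      also have "\<dots> = 2 * (2 * N + D) * q \<tau>" by (simp add: g algebra_simps)
      finally show "norm ?I \<le> 2 * (2 * N + D) * q \<tau>" using bounds(2) by linarith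
    qed
  qed
  show ?thesis
    by (rule exI[of _ "D / 2"], rule conjI, use D in simp, rule exI[of _ "2 * (2 * N + D)"], rule conjI,
        use D N in simp, rule exI[of _ m], use main in \<open>simp add: q_def\<close>)
qed

section \<open>The rate of convergence\<close>

text \<open>
  A polynomial loss in \<open>\<tau>\<close> costs only \<open>ln \<tau> / \<tau>\<close> in the exponential rate.  The exponent \<open>m + 1\<close>, in
  place of \<open>m\<close>, makes the coefficient of the logarithm positive.
\<close>
lemma log_rate_bound:
  fixes X \<tau> k C1 C2 :: real
  assumes C: "0 < C1" "0 < C2" and \<tau>: "1 \<le> \<tau>"
    and lb: "C1 / \<tau> ^ m * exp (- (k * \<tau>)) \<le> X" and ub: "X \<le> C2 * exp (- (k * \<tau>))"
  shows "\<bar>ln X / \<tau> + k\<bar> \<le> (\<bar>ln C1\<bar> + \<bar>ln C2\<bar> + real (m + 1) * ln \<tau>) / \<tau>"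
proof -
  have pos: "0 < C1 / \<tau> ^ m * exp (- (k * \<tau>))" using C \<tau> by simp
  with lb have X: "0 < X" by linarith
  have "ln (C1 / \<tau> ^ m * exp (- (k * \<tau>))) = ln C1 - real m * ln \<tau> - k * \<tau>"
    using C \<tau> by (simp add: ln_mult ln_div ln_realpow)
  hence "ln C1 - real m * ln \<tau> - k * \<tau> \<le> ln X" using pos lb ln_le_cancel_iff[OF pos X] by simp
  moreover have "ln (C2 * exp (- (k * \<tau>))) = ln C2 - k * \<tau>" using C by (simp add: ln_mult)
  hence "ln X \<le> ln C2 - k * \<tau>" using ub X C ln_le_cancel_iff[OF X, of "C2 * exp (- (k * \<tau>))"] by simp
  moreover have "0 \<le> ln \<tau>" "0 \<le> real m * ln \<tau>" using \<tau> by simp_all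
  ultimately have "\<bar>ln X + k * \<tau>\<bar> \<le> \<bar>ln C1\<bar> + \<bar>ln C2\<bar> + real (m + 1) * ln \<tau>"
    unfolding of_nat_add of_nat_1 distrib_right by linarith
  hence "\<bar>ln X + k * \<tau>\<bar> / \<tau> \<le> (\<bar>ln C1\<bar> + \<bar>ln C2\<bar> + real (m + 1) * ln \<tau>) / \<tau>"
    using \<tau> by (intro divide_right_mono) auto
  moreover have "ln X / \<tau> + k = (ln X + k * \<tau>) / \<tau>" using \<tau> by (simp add: field_simps)
  ultimately show ?thesis using \<tau> by (simp add: abs_divide)
qed

lemma log_rate_bigo:
  fixes K m s :: real
  assumes "0 < s" "0 < m"
  shows "(\<lambda>L. (K + m * ln (s * L)) / (s * L)) \<in> O[at_top](\<lambda>L. \<bar>ln L\<bar> / L)"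
  using assms by real_asymp

theorem corollary1p2:
  fixes a T T' M c \<sigma> :: real and u ux :: "real \<Rightarrow> real \<Rightarrow> real" and p :: "real poly"
  assumes "a > 0" and "T > 0"
    and "heat_solution a T u ux"
    and "\<And>t. t \<in> {0<..<T} \<Longrightarrow> ux a t = 0"
    and "\<And>x. x \<in> {0<..<a} \<Longrightarrow> u x 0 = 0"
    and "M > 0" and "M \<ge> 2 * a"
    and "0 < T'" and "T' \<le> T"
    and "c > 0" and "M * c < min T (2 * T')"
    and "\<exists>k. coeff p k \<noteq> 0"
    and "\<And>t. t \<in> {0<..<T'} \<Longrightarrow> ux 0 t = poly p t"
    and "0 < \<sigma>" and "\<sigma> < 1"
  shows "(\<forall>\<^sub>F \<delta> in at_right 0.
            (\<forall>(E1, E2) \<in> noise_ball T \<delta>. I_c T u ux c (\<tau>_sel T \<sigma> \<delta>) E1 E2 \<noteq> 0) \<and>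
            bdd_above (deviation a T u ux c (\<tau>_sel T \<sigma> \<delta>) ` noise_ball T \<delta>)) \<and>
         (\<lambda>\<delta>. SUP E \<in> noise_ball T \<delta>. deviation a T u ux c (\<tau>_sel T \<sigma> \<delta>) E)
           \<in> O[at_right 0](\<lambda>\<delta>. \<bar>ln \<bar>ln \<delta>\<bar>\<bar> / \<bar>ln \<delta>\<bar>)"
proof -
  have "2 * a * c \<le> M * c" using assms(7,10) by (intro mult_right_mono) auto
  hence "2 * a * c < T" using assms(11) by simp
  moreover have "p \<noteq> 0" using assms(12) by auto
  ultimately obtain C1 C2 m where C: "0 < C1" "0 < C2" and bnd:
    "\<forall>\<^sub>F \<tau> in at_top. \<forall>(E1, E2) \<in> noise_ball T (exp (- (T * \<tau>))).
           C1 / \<tau> ^ m * exp (- (2 * c * a * \<tau>)) \<le> norm (I_c T u ux c \<tau> E1 E2) \<and>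
           norm (I_c T u ux c \<tau> E1 E2) \<le> C2 * exp (- (2 * c * a * \<tau>))"
    using indicator_two_sided_bound[OF assms(1-5,10) _ assms(8,9) _ assms(13)] by blast
  define K where "K = \<bar>ln C1\<bar> + \<bar>ln C2\<bar>"
  define rate where "rate \<tau> = (K + real (m + 1) * ln \<tau>) / \<tau>" for \<tau> :: real
  let ?\<tau> = "\<tau>_sel T \<sigma>"
  have sel: "filterlim ?\<tau> at_top (at_right 0)"
    unfolding \<tau>_sel_def using assms(2,14) by real_asymp
  have "\<forall>\<^sub>F \<delta> in at_right 0. \<delta> < (1::real)"
    by (rule order_tendstoD(2)[OF tendsto_ident_at]) simp
  hence dev: "\<forall>\<^sub>F \<delta> in at_right 0. \<forall>E \<in> noise_ball T \<delta>.
      I_c T u ux c (?\<tau> \<delta>) (fst E) (snd E) \<noteq> 0 \<and> deviation a T u ux c (?\<tau> \<delta>) E \<le> rate (?\<tau> \<delta>)"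
    using eventually_at_right_less[of "0::real"] eventually_compose_filterlim[OF bnd sel]
      eventually_compose_filterlim[OF eventually_ge_at_top[of 1] sel]
  proof eventually_elim
    case (elim \<delta>)
    \<comment> \<open>As \<sigma> < 1, the noise level \<delta> = exp (- T \<tau> / \<sigma>) is below exp (- T \<tau>).\<close>
    have "T * ?\<tau> \<delta> = - (\<sigma> * ln \<delta>)" using elim assms(2) by (simp add: \<tau>_sel_def)
    moreover have "\<sigma> * ln \<delta> \<ge> 1 * ln \<delta>" using elim assms(15) by (intro mult_right_mono_neg) auto
    ultimately have "\<delta> \<le> exp (- (T * ?\<tau> \<delta>))" using elim by (simp add: ln_ge_iff[symmetric] ln_le_cancel_iff[symmetric] del: ln_le_cancel_iff)
    hence sub: "noise_ball T \<delta> \<subseteq> noise_ball T (exp (- (T * ?\<tau> \<delta>)))"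
      by (auto simp: noise_ball_def)
    show ?case
    proof
      fix E assume "E \<in> noise_ball T \<delta>"
      with sub have E: "E \<in> noise_ball T (exp (- (T * ?\<tau> \<delta>)))" by blast
      let ?X = "norm (I_c T u ux c (?\<tau> \<delta>) (fst E) (snd E))"
      have X: "C1 / ?\<tau> \<delta> ^ m * exp (- (2 * c * a * ?\<tau> \<delta>)) \<le> ?X" "?X \<le> C2 * exp (- (2 * c * a * ?\<tau> \<delta>))"
        using elim(3) E by (auto simp: case_prod_beta)
      have "0 < C1 / ?\<tau> \<delta> ^ m * exp (- (2 * c * a * ?\<tau> \<delta>))" using C elim by simp
      hence "0 < ?X" using X by linarith
      moreover have "deviation a T u ux c (?\<tau> \<delta>) E \<le> rate (?\<tau> \<delta>)"
        using log_rate_bound[OF C elim(4) X] by (simp add: deviation_def case_prod_beta rate_def K_def)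
      ultimately show "I_c T u ux c (?\<tau> \<delta>) (fst E) (snd E) \<noteq> 0 \<and> deviation a T u ux c (?\<tau> \<delta>) E \<le> rate (?\<tau> \<delta>)"
        by simp
    qed
  qed
  have "\<forall>\<^sub>F \<delta> in at_right 0. norm (SUP E \<in> noise_ball T \<delta>. deviation a T u ux c (?\<tau> \<delta>) E) \<le> norm (rate (?\<tau> \<delta>))"
    using dev eventually_at_right_less[of "0::real"]
  proof eventually_elim
    case (elim \<delta>)
    have zero: "((\<lambda>_. 0), (\<lambda>_. 0)) \<in> noise_ball T \<delta>"
      using elim(2) by (simp add: noise_ball_def square_integrable_def L2_norm_def
          set_borel_measurable_def set_integrable_def set_lebesgue_integral_def)
    have bdd: "bdd_above (deviation a T u ux c (?\<tau> \<delta>) ` noise_ball T \<delta>)"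
      using elim(1) by (intro bdd_aboveI2[of _ _ "rate (?\<tau> \<delta>)"]) auto
    have "(SUP E \<in> noise_ball T \<delta>. deviation a T u ux c (?\<tau> \<delta>) E) \<le> rate (?\<tau> \<delta>)"
      using zero elim(1) by (intro cSUP_least) auto
    moreover have "0 \<le> deviation a T u ux c (?\<tau> \<delta>) ((\<lambda>_. 0), (\<lambda>_. 0))"
      by (simp add: deviation_def)
    hence "0 \<le> (SUP E \<in> noise_ball T \<delta>. deviation a T u ux c (?\<tau> \<delta>) E)"
      using cSUP_upper[OF zero bdd] by linarith
    ultimately show ?case by simp
  qed
  hence "(\<lambda>\<delta>. SUP E \<in> noise_ball T \<delta>. deviation a T u ux c (?\<tau> \<delta>) E) \<in> O[at_right 0](\<lambda>\<delta>. rate (?\<tau> \<delta>))"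
    by (rule landau_o.big_mono)
  also have "(\<lambda>\<delta>. rate (?\<tau> \<delta>)) \<in> O[at_right 0](\<lambda>\<delta>. \<bar>ln \<bar>ln \<delta>\<bar>\<bar> / \<bar>ln \<delta>\<bar>)"
  proof -
    have "filterlim (\<lambda>\<delta>::real. \<bar>ln \<delta>\<bar>) at_top (at_right 0)" by real_asymp
    from landau_o.big.compose[OF log_rate_bigo[of "\<sigma> / T" "real (m + 1)" K] this]
    show ?thesis using assms(2,14) by (simp add: rate_def \<tau>_sel_def)
  qed
  finally have "(\<lambda>\<delta>. SUP E \<in> noise_ball T \<delta>. deviation a T u ux c (?\<tau> \<delta>) E)
           \<in> O[at_right 0](\<lambda>\<delta>. \<bar>ln \<bar>ln \<delta>\<bar>\<bar> / \<bar>ln \<delta>\<bar>)" .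
  moreover from dev have "\<forall>\<^sub>F \<delta> in at_right 0.
            (\<forall>(E1, E2) \<in> noise_ball T \<delta>. I_c T u ux c (?\<tau> \<delta>) E1 E2 \<noteq> 0) \<and>
            bdd_above (deviation a T u ux c (?\<tau> \<delta>) ` noise_ball T \<delta>)"
  proof eventually_elim
    case (elim \<delta>)
    thus ?case by (fastforce intro!: bdd_aboveI2[of _ _ "rate (?\<tau> \<delta>)"])
  qed
  ultimately show ?thesis by blast
qed

end
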